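(* Let $F:\mathbb{R}^N\to\mathbb{R}\cup\{+\infty\}$ be a proper, closed, convex function with $\operatorname{dom}(F)\subset\Lambda$. Assume $\mu$ is absolutely continuous with respect to Lebesgue measure and $c$ satisfies the twist condition. If $(\hat\varphi,\hat\psi)\in C(X)\times\mathbb{R}^N$ is a maximizing pair in the dual problem and $(\tilde\gamma,\tilde\lambda)$ is a minimizing pair in the primal problem, then (i) $\hat\psi\in\partial F(\tilde\lambda)$, and (ii) $\tilde\lambda^j=\mu\left(\{x\in X: -c(x,y_j)-\hat\psi^j=\hat\psi^{c^*}(x)\}\right)$ for every $1\le j\le N$. Furthermore, (iii) if $\tilde\lambda^j>0$ for some $1\le j\le N$, then $\hat\psi^j=(\hat\psi^{c^*c})^j$ for that $j$. Conversely, if $\tilde\lambda\in\Lambda$ and $\hat\psi\in\mathbb{R}^N$ are such that (i) and (ii) hold, then $(\hat\psi^{c^*},\hat\psi)$ is a maximizing pair in the dual problem and $((\mathrm{Id}\times T_{\hat\psi})_\#\mu,\tilde\lambda)$ is a minimizing pair in the primal problem.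
   Context: Fix positive integers $N,n$, a set $Y=\{y_j\}_{j=1}^N\subset\mathbb{R}^n$ of $N$ points, a compact set $X\subset\mathbb{R}^n$, and a Borel probability measure $\mu$ on $X$ with $\operatorname{spt}\mu=X$. The cost $c:X\times Y\to\mathbb{R}_{\ge0}$ is continuous and $c(\cdot,y_j)\in C^1(X)$ for each $1\le j\le N$. Write $\Lambda=\{\lambda\in\mathbb{R}^N: \sum_{j=1}^N\lambda^j=1,\ \lambda^j\ge 0\}$ and, for $\lambda\in\Lambda$, $\nu_\lambda=\sum_{j=1}^N\lambda^j\delta_{y_j}$. $\Pi(\mu,\nu)$ is the set of probability measures on $X\times Y$ with left and right marginals $\mu$ and $\nu$. For convex $F$, $\operatorname{dom}(F)=\{x: F(x)<\infty\}$; proper means not identically $+\infty$; closed means lower semicontinuous. The Legendre transform is $F^*(\psi)=\sup_{\lambda\in\mathbb{R}^N}(\langle\psi,\lambda\rangle-F(\lambda))$, and the subdifferential is $\partial F(x)=\{p\in\mathbb{R}^N: F(y)\ge F(x)+\langle y-x,p\rangle\ \forall y\in\mathbb{R}^N\}$. Twist condition: for each $x_0\in X$ and all $j\ne k$, $-\nabla_x c(x_0,y_j)\ne-\nabla_x c(x_0,y_k)$. Primal problem: minimize $\int_{X\times Y}c\,d\gamma+F(\lambda)$ over pairs $(\gamma,\lambda)$ with $\lambda\in\Lambda$, $\gamma\in\Pi(\mu,\nu_\lambda)$. Dual problem: maximize $-\int_X\varphi\,d\mu-F^*(\psi)$ over $(\varphi,\psi)\in C(X)\times\mathbb{R}^N$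 with $-\varphi(x)-\psi^j\le c(x,y_j)$ for all $x\in X$, $1\le j\le N$. For $\psi\in\mathbb{R}^N$, $\psi^{c^*}:X\to\mathbb{R}$ is $\psi^{c^*}(x)=\max_{1\le j\le N}(-c(x,y_j)-\psi^j)$; for $\varphi:X\to\mathbb{R}\cup\{+\infty\}$ not identically $+\infty$, $\varphi^c\in\mathbb{R}^N$ has components $(\varphi^c)^j=\sup_{x\in X}(-c(x,y_j)-\varphi(x))$; $\psi^{c^*c}=(\psi^{c^*})^c$. Under absolute continuity of $\mu$ and the twist condition, for $\mu$-a.e. $x$ there is a unique index $j$ with $\psi^{c^*}(x)=-c(x,y_j)-\psi^j$; the map $T_\psi:X\to Y$ is defined ($\mu$-a.e.) by $T_\psi(x)=y_j$ for this unique $j$. $(\mathrm{Id}\times T_\psi)_\#\mu$ is the pushforward of $\mu$ under $x\mapsto(x,T_\psi(x))$. *)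

theory Defs
  imports "HOL-Probability.Probability"
begin

text \<open>
  The points of \<open>Y\<close> are enumerated by \<open>y :: 'm \<Rightarrow> real^'n\<close> with \<open>inj y\<close>, so \<open>N = CARD('m)\<close>
  and vectors of \<open>\<real>\<^sup>N\<close> are elements of \<open>real^'m\<close>. Measures on \<open>X\<close>, \<open>Y\<close> and \<open>X \<times> Y\<close> have
  exactly these sets as their spaces. The cost and the functions on \<open>X\<close> are total HOL functions;
  only their values on \<open>X \<times> Y\<close>, respectively \<open>X\<close>, are ever used.
\<close>

abbreviation borel_on :: "'a::topological_space set \<Rightarrow> 'a measure" where
  "borel_on S \<equiv> restrict_space borel S"

definition spt :: "'a::topological_space measure \<Rightarrow> 'a set" where
  "spt M = {x \<in> space M. \<forall>U. open U \<and> x \<in> U \<longrightarrow> 0 < emeasure M (U \<inter> space M)}"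

text \<open>
  \<open>f \<in> C\<^sup>1(X)\<close> with gradient \<open>g\<close>. The derivative is taken within \<open>X\<close>, so restrictions of functions
  that are \<open>C\<^sup>1\<close> near \<open>X\<close> are covered. If \<open>X\<close> is the support of an absolutely continuous measure,
  then its Lebesgue density points are dense in \<open>X\<close>; the derivative is unique there and, \<open>g\<close> being
  continuous, \<open>g\<close> is determined on all of \<open>X\<close>.
\<close>

definition C1_with_gradient ::
    "(real^'n) set \<Rightarrow> (real^'n \<Rightarrow> real) \<Rightarrow> (real^'n \<Rightarrow> real^'n) \<Rightarrow> bool" where
  "C1_with_gradient X f g \<longleftrightarrow>
     continuous_on X g \<and> (\<forall>x\<in>X. (f has_derivative (\<lambda>h. g x \<bullet> h)) (at x within X))"

text \<open>Here \<open>Dc j\<close> is the gradient of \<open>x \<mapsto> c(x, y\<^sub>j)\<close>.\<close>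

definition twist :: "(real^'n) set \<Rightarrow> ('m \<Rightarrow> real^'n \<Rightarrow> real^'n) \<Rightarrow> bool" where
  "twist X Dc \<longleftrightarrow> (\<forall>x0\<in>X. \<forall>j k. j \<noteq> k \<longrightarrow> - Dc j x0 \<noteq> - Dc k x0)"


definition effective_domain :: "('a \<Rightarrow> ereal) \<Rightarrow> 'a set" where
  "effective_domain F = {x. F x < \<infinity>}"

definition proper :: "('a \<Rightarrow> ereal) \<Rightarrow> bool" where
  "proper F \<longleftrightarrow> (\<exists>x. F x \<noteq> \<infinity>)"

definition lsc :: "('a::topological_space \<Rightarrow> ereal) \<Rightarrow> bool" where
  "lsc F \<longleftrightarrow> (\<forall>x. F x \<le> Liminf (at x) F)"

text \<open>Only used for functions that avoid \<open>-\<infinity>\<close>; note \<open>0 * \<infinity> = 0\<close> in \<open>ereal\<close>.\<close>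

definition ereal_convex :: "('a::real_vector \<Rightarrow> ereal) \<Rightarrow> bool" where
  "ereal_convex F \<longleftrightarrow> (\<forall>x z. \<forall>t\<in>{0..1}.
     F ((1 - t) *\<^sub>R x + t *\<^sub>R z) \<le> ereal (1 - t) * F x + ereal t * F z)"

definition legendre :: "('a::real_inner \<Rightarrow> ereal) \<Rightarrow> 'a \<Rightarrow> ereal" where
  "legendre F \<psi> = (SUP l. ereal (\<psi> \<bullet> l) - F l)"

definition subdifferential :: "('a::real_inner \<Rightarrow> ereal) \<Rightarrow> 'a \<Rightarrow> 'a set" where
  "subdifferential F x = {p. \<forall>z. F z \<ge> F x + ereal ((z - x) \<bullet> p)}"


definition simplex_weights :: "(real^'m) set" where
  "simplex_weights = {l. (\<Sum>j\<in>UNIV. l $ j) = 1 \<and> (\<forall>j. l $ j \<ge> 0)}"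

text \<open>\<open>\<nu>\<^sub>\<lambda> = \<Sum>\<^sub>j \<lambda>\<^sup>j \<delta>\<^bsub>y\<^sub>j\<^esub>\<close> as a measure on \<open>Y\<close>.\<close>

definition nu :: "('m::finite \<Rightarrow> real^'n) \<Rightarrow> real^'m \<Rightarrow> (real^'n) measure" where
  "nu y l = measure_of (range y) (sets (borel_on (range y)))
     (\<lambda>A. \<Sum>j\<in>UNIV. ennreal (l $ j) * indicator A (y j))"

definition couplings :: "'a measure \<Rightarrow> 'b measure \<Rightarrow> ('a \<times> 'b) measure set" where
  "couplings M N = {\<gamma>. prob_space \<gamma> \<and> sets \<gamma> = sets (M \<Otimes>\<^sub>M N) \<and>
     distr \<gamma> M fst = M \<and> distr \<gamma> N snd = N}"

definition primal_feasible ::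
    "(real^'n) measure \<Rightarrow> ('m::finite \<Rightarrow> real^'n) \<Rightarrow>
     ((real^'n) \<times> (real^'n)) measure \<times> (real^'m) \<Rightarrow> bool" where
  "primal_feasible \<mu> y = (\<lambda>(\<gamma>, l). l \<in> simplex_weights \<and> \<gamma> \<in> couplings \<mu> (nu y l))"

definition primal_value ::
    "((real^'n) \<times> (real^'n) \<Rightarrow> real) \<Rightarrow> (real^'m \<Rightarrow> ereal) \<Rightarrow>
     ((real^'n) \<times> (real^'n)) measure \<times> (real^'m) \<Rightarrow> ereal" where
  "primal_value c F = (\<lambda>(\<gamma>, l). ereal (\<integral>z. c z \<partial>\<gamma>) + F l)"

definition dual_feasible ::
    "(real^'n) set \<Rightarrow> ('m::finite \<Rightarrow> real^'n) \<Rightarrow> ((real^'n) \<times> (real^'n) \<Rightarrow> real) \<Rightarrow>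
     (real^'n \<Rightarrow> real) \<times> (real^'m) \<Rightarrow> bool" where
  "dual_feasible X y c = (\<lambda>(\<phi>, \<psi>). continuous_on X \<phi> \<and>
     (\<forall>x\<in>X. \<forall>j. - \<phi> x - \<psi> $ j \<le> c (x, y j)))"

definition dual_value ::
    "(real^'n) measure \<Rightarrow> (real^'m::finite \<Rightarrow> ereal) \<Rightarrow>
     (real^'n \<Rightarrow> real) \<times> (real^'m) \<Rightarrow> ereal" where
  "dual_value \<mu> F = (\<lambda>(\<phi>, \<psi>). ereal (- (\<integral>x. \<phi> x \<partial>\<mu>)) - legendre F \<psi>)"

definition primal_minimizer where
  "primal_minimizer \<mu> y c F p \<longleftrightarrow> is_arg_min (primal_value c F) (primal_feasible \<mu> y) p"

definition dual_maximizer where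
  "dual_maximizer X \<mu> y c F p \<longleftrightarrow> is_arg_max (dual_value \<mu> F) (dual_feasible X y c) p"


definition cstar_transform ::
    "('m::finite \<Rightarrow> real^'n) \<Rightarrow> ((real^'n) \<times> (real^'n) \<Rightarrow> real) \<Rightarrow> real^'m \<Rightarrow> real^'n \<Rightarrow> real" where
  "cstar_transform y c \<psi> x = Max (range (\<lambda>j. - c (x, y j) - \<psi> $ j))"

text \<open>The components \<open>(\<phi>\<^sup>c)\<^sup>j\<close>, as extended reals because \<open>\<phi>\<close> need not be bounded below.\<close>

definition c_transform ::
    "(real^'n) set \<Rightarrow> ('m \<Rightarrow> real^'n) \<Rightarrow> ((real^'n) \<times> (real^'n) \<Rightarrow> real) \<Rightarrow>
     (real^'n \<Rightarrow> ereal) \<Rightarrow> 'm \<Rightarrow> ereal" where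
  "c_transform X y c \<phi> j = (SUP x\<in>X. ereal (- c (x, y j)) - \<phi> x)"

text \<open>
  \<open>T\<^sub>\<psi>\<close> is only meaningful where the maximizing index is unique. Elsewhere \<open>THE\<close> still returns some
  index, which depends on \<open>x\<close> only through the (finitely many possible) sets of maximizing indices.
  Hence the total function is measurable, maps into \<open>Y\<close>, and its push-forward is unaffected
  by these values when the exceptional set is null.
\<close>

definition transport_map ::
    "('m::finite \<Rightarrow> real^'n) \<Rightarrow> ((real^'n) \<times> (real^'n) \<Rightarrow> real) \<Rightarrow> real^'m \<Rightarrow> real^'n \<Rightarrow> real^'n" where
  "transport_map y c \<psi> x = y (THE j. cstar_transform y c \<psi> x = - c (x, y j) - \<psi> $ j)"

definition graph_pushforward ::
    "(real^'n) set \<Rightarrow> ('m::finite \<Rightarrow> real^'n) \<Rightarrow> (real^'n) measure \<Rightarrow> (real^'n \<Rightarrow> real^'n) \<Rightarrow>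
     ((real^'n) \<times> (real^'n)) measure" where
  "graph_pushforward X y \<mu> T = distr \<mu> (borel_on X \<Otimes>\<^sub>M borel_on (range y)) (\<lambda>x. (x, T x))"

end

theory Submission
  imports Defs
begin

text \<open>
  Write \<open>H \<psi> = \<integral> \<psi>\<^sup>c\<^sup>* d\<mu>\<close>. Enlarging \<open>\<psi>\<^sup>c\<^sup>*\<close> only costs, so the dual problem amounts to minimizing
  \<open>H + F\<^sup>*\<close> over \<open>\<psi>\<close>. Say that \<open>x\<close> lies in the cell of \<open>j\<close> if the maximum that defines \<open>\<psi>\<^sup>c\<^sup>* x\<close> is
  attained at \<open>j\<close>; condition (ii) says that \<open>\<lambda>\<close> is the vector of \<open>\<mu>\<close>-masses of the cells.

  Two cells overlap only where \<open>c(\<sqdot>, y\<^sub>j) - c(\<sqdot>, y\<^sub>k)\<close> takes one particular value. Its gradient never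
  vanishes by the twist condition, so this set is Lebesgue null and hence \<open>\<mu>\<close>-null
  (\<open>null_zero_set_if_gradient_nonzero\<close>, \<open>twist_no_ties\<close>). Almost every point therefore has a unique
  cell, and by dominated convergence \<open>H\<close> is differentiable, its gradient being minus the vector of
  cell masses (\<open>integral_cs_directional_derivative\<close>).

  For any coupling \<open>\<gamma>\<close> of \<open>\<mu>\<close> and \<open>\<nu>\<^sub>\<lambda>\<close>, the primal value exceeds \<open>- H \<psi> - F\<^sup>* \<psi>\<close> by the sum of two
  nonnegative terms: the integral of the slack \<open>c(x, y\<^sub>j) + \<psi>\<^sup>c\<^sup>* x + \<psi>\<^sup>j\<close> against \<open>\<gamma>\<close>, and the
  Fenchel-Young gap \<open>F \<lambda> + F\<^sup>* \<psi> - \<psi> \<bullet> \<lambda>\<close>. The gap vanishes exactly under (i). The slack vanishes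
  exactly on the cells, which forces (ii); conversely (ii) makes \<open>(Id \<times> T\<^sub>\<psi>)\<^sub># \<mu>\<close> a coupling whose slack
  integral is zero (\<open>graph_pushforward_coupling\<close>). So (i) and (ii) yield a primal and a dual
  competitor of equal value, and both are optimal.

  For the direct implication, the absence of a duality gap comes from the dual maximizer itself. If
  \<open>\<psi>\<close> belongs to it and \<open>m\<close> is its vector of cell masses, the first order condition at the minimizer \<open>\<psi>\<close> of
  \<open>H + F\<^sup>*\<close> says that \<open>m\<close> is a subgradient of \<open>F\<^sup>*\<close> at \<open>\<psi>\<close>. The Fenchel-Moreau theorem turns this
  into (i) for \<open>m\<close> in place of \<open>\<lambda>\<close>, so the transport map gives a primal competitor that attains the
  dual value. Every primal minimizer then attains it too, which makes both of its nonnegative terms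
  zero. Finally, a cell of positive mass is nonempty, and at any of its points the supremum defining
  the double transform attains \<open>\<psi>\<^sup>j\<close>.
\<close>

section \<open>Level sets with nonvanishing gradient\<close>

text \<open>
  The singletons form a relatively open cover of \<open>S\<close>, which has a countable subcover by the Lindelof
  property.
\<close>

lemma countable_if_all_points_isolated:
  fixes S :: "'a::second_countable_topology set"
  assumes "\<And>x. x \<in> S \<Longrightarrow> \<not> x islimpt S"
  shows "countable S"
proof -
  have "openin (top_of_set S) A" if A: "A \<in> (\<lambda>x. {x}) ` S" for A
  proof -
    from A obtain x where x: "x \<in> S" "A = {x}"
      by blast
    from assms[OF x(1)] obtain T where T: "open T" "x \<in> T" "\<forall>z\<in>S. z \<in> T \<longrightarrow> z = x"
      unfolding islimpt_def by blast
    have "A = S \<inter> T" unfolding x(2) using x(1) T(2,3) by blast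
    with \<open>open T\<close> show ?thesis
      by (auto simp: openin_open)
  qed
  then obtain G where G: "G \<subseteq> (\<lambda>x. {x}) ` S" "countable G" "\<Union>G = \<Union>((\<lambda>x. {x}) ` S)"
    by (rule Lindelof_openin)
  then have "S = (\<Union>A\<in>G. A)" by simp
  also have "countable \<dots>"
    using G by (intro countable_UN) (auto intro: countable_finite)
  finally show ?thesis .
qed

text \<open>
  Averaging the measures of the translates \<open>B - t e\<close>, which all equal that of \<open>B\<close>, over \<open>t \<in> [0, 1]\<close>
  and exchanging the integrals reduces the claim to the one-dimensional sections.
\<close>

lemma lborel_null_if_countable_on_parallel_lines:
  fixes B :: "'a::euclidean_space set"
  assumes [measurable]: "B \<in> sets borel"
    and lines: "\<And>x. countable {t::real. x + t *\<^sub>R e \<in> B}"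
  shows "B \<in> null_sets lborel"
proof -
  have shift: "(\<integral>\<^sup>+x. indicator B (x + t *\<^sub>R e) \<partial>lborel) = emeasure lborel B" for t :: real
  proof -
    have "(\<integral>\<^sup>+x. indicator B x \<partial>lborel) = (\<integral>\<^sup>+x. indicator B x \<partial>(distr lborel borel ((+) (t *\<^sub>R e))))"
      by (simp add: lborel_distr_plus)
    also have "\<dots> = (\<integral>\<^sup>+x. indicator B (t *\<^sub>R e + x) \<partial>lborel)"
      by (rule nn_integral_distr) auto
    finally show ?thesis
      by (simp add: add.commute)
  qed
  have "emeasure lborel B = (\<integral>\<^sup>+t. indicator {0..1::real} t * emeasure lborel B \<partial>lborel)"
    by (simp add: nn_integral_multc)
  also have "\<dots> = (\<integral>\<^sup>+t. (\<integral>\<^sup>+x. indicator {0..1} t * indicator B (x + t *\<^sub>R e) \<partial>lborel) \<partial>lborel)"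
    by (simp add: nn_integral_cmult shift)
  also have "\<dots> = (\<integral>\<^sup>+x. (\<integral>\<^sup>+t. indicator {0..1} t * indicator B (x + t *\<^sub>R e) \<partial>lborel) \<partial>lborel)"
    by (rule lborel_pair.Fubini'[symmetric]) measurable
  also have "\<dots> = (\<integral>\<^sup>+x. 0 \<partial>(lborel :: 'a measure))"
  proof (rule nn_integral_cong)
    fix x :: 'a
    have "AE t in lborel. t \<notin> {t. x + t *\<^sub>R e \<in> B}"
      by (rule AE_not_in, rule countable_imp_null_set_lborel, rule lines)
    then have "AE t in lborel. indicator {0..1} t * (indicator B (x + t *\<^sub>R e) :: ennreal) = 0"
      by eventually_elim simp
    then show "(\<integral>\<^sup>+t. indicator {0..1} t * indicator B (x + t *\<^sub>R e) \<partial>lborel) = 0"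
      by (subst nn_integral_0_iff_AE) auto
  qed
  finally show ?thesis
    by auto
qed

text \<open>
  Along the line, \<open>f\<close> grows like \<open>(t - s) D e\<close> to first order. As \<open>D\<close> is only a derivative within
  \<open>S\<close>, the estimate holds just for those parameters whose points lie in \<open>S\<close>, and the claim is only
  about those.
\<close>

lemma directional_zeros_isolated:
  fixes S :: "'a::euclidean_space set" and f :: "'a \<Rightarrow> real"
  assumes der: "(f has_derivative D) (at p within S)"
    and "D e \<noteq> 0" and "f p = 0"
    and p: "p = x + s *\<^sub>R e"
  shows "\<not> s islimpt {t. x + t *\<^sub>R e \<in> S \<and> f (x + t *\<^sub>R e) = 0}"
proof -
  \<comment> \<open>The error tolerance: small enough for the first order term to dominate, also if \<open>e\<close> is long.\<close>
  define r where "r = \<bar>D e\<bar> / (2 * (norm e + 1))"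
  have r: "r > 0" "r * norm e < \<bar>D e\<bar>"
  proof -
    show "r > 0" using \<open>D e \<noteq> 0\<close> by (auto simp: r_def intro!: divide_pos_pos add_nonneg_pos)
    have "r * norm e \<le> r * (norm e + 1)" using \<open>r > 0\<close> by simp
    also have "\<dots> = \<bar>D e\<bar> / 2" 
      using norm_ge_zero[of e] unfolding r_def by (simp add: divide_simps add_nonneg_eq_0_iff)
    finally show "r * norm e < \<bar>D e\<bar>" using \<open>D e \<noteq> 0\<close> by linarith
  qed
  from der r(1) obtain d where d: "d > 0" and small:
      "\<And>z. z \<in> S \<Longrightarrow> norm (z - p) < d \<Longrightarrow> norm (f z - f p - D (z - p)) \<le> r * norm (z - p)"
    unfolding has_derivative_within_alt by blast
  have lin: "bounded_linear D" using der by (rule has_derivative_bounded_linear)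
  have "t = s" if t: "\<bar>t - s\<bar> < d / (norm e + 1)" "x + t *\<^sub>R e \<in> S" "f (x + t *\<^sub>R e) = 0" for t
  proof (rule ccontr)
    assume "t \<noteq> s"
    have eq: "x + t *\<^sub>R e - p = (t - s) *\<^sub>R e"
      by (simp add: p algebra_simps)
    have "\<bar>t - s\<bar> * norm e \<le> \<bar>t - s\<bar> * (norm e + 1)" by (simp add: mult_left_mono)
    also have "\<dots> < d" using t(1) by (simp add: pos_less_divide_eq add_nonneg_pos)
    finally have "norm (x + t *\<^sub>R e - p) < d" by (simp add: eq)
    from small[OF t(2) this] have "norm (D ((t - s) *\<^sub>R e)) \<le> r * norm ((t - s) *\<^sub>R e)"
      using t(3) \<open>f p = 0\<close> unfolding eq by simp
    then have "\<bar>t - s\<bar> * \<bar>D e\<bar> \<le> \<bar>t - s\<bar> * (r * norm e)"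
      by (simp add: linear_scale[OF bounded_linear.linear[OF lin]] abs_mult mult_ac)
    with \<open>t \<noteq> s\<close> r(2) show False by simp
  qed
  then have "\<forall>t. x + t *\<^sub>R e \<in> S \<and> f (x + t *\<^sub>R e) = 0 \<and> dist t s < d / (norm e + 1) \<longrightarrow> t = s"
    by (auto simp: dist_real_def)
  moreover have "d / (norm e + 1) > 0" using d by (simp add: add_nonneg_pos)
  ultimately show ?thesis
    unfolding islimpt_approachable by (metis (mono_tags, lifting) mem_Collect_eq)
qed

text \<open>
  As \<open>S\<close> may have empty interior and the derivative is taken within \<open>S\<close>, the zero set need not be a
  hypersurface. It is split according to a coordinate direction \<open>e\<close> in which
  the gradient has a nonzero component. On each line parallel to \<open>e\<close> the zeros of this kind are
  isolated, hence countable.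
\<close>

lemma null_zero_set_if_gradient_nonzero:
  fixes S :: "'a::euclidean_space set" and f :: "'a \<Rightarrow> real"
  assumes "closed S" and "continuous_on S f" and "continuous_on S g"
    and der: "\<And>x. x \<in> S \<Longrightarrow> (f has_derivative (\<lambda>h. g x \<bullet> h)) (at x within S)"
    and "\<And>x. x \<in> S \<Longrightarrow> g x \<noteq> 0"
  shows "{x \<in> S. f x = 0} \<in> null_sets lborel"
proof -
  define B where "B e = {x \<in> S. f x = 0 \<and> g x \<bullet> e \<noteq> 0}" for e
  have "B e \<in> null_sets lborel" for e
  proof (rule lborel_null_if_countable_on_parallel_lines[where e = e])
    have "closed (S \<inter> f -` {0})" "closed (S \<inter> (\<lambda>x. g x \<bullet> e) -` {0})"
      using assms(1-3) by (intro continuous_closed_preimage continuous_intros closed_singleton; simp)+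
    moreover have "B e = S \<inter> f -` {0} - S \<inter> (\<lambda>x. g x \<bullet> e) -` {0}"
      by (auto simp: B_def)
    ultimately show "B e \<in> sets borel" by simp
  next
    fix x
    show "countable {t. x + t *\<^sub>R e \<in> B e}"
    proof (rule countable_if_all_points_isolated)
      fix s assume "s \<in> {t. x + t *\<^sub>R e \<in> B e}"
      then have s: "x + s *\<^sub>R e \<in> S" "f (x + s *\<^sub>R e) = 0" "g (x + s *\<^sub>R e) \<bullet> e \<noteq> 0"
        by (auto simp: B_def)
      have "\<not> s islimpt {t. x + t *\<^sub>R e \<in> S \<and> f (x + t *\<^sub>R e) = 0}"
        using s(2,3) by (intro directional_zeros_isolated[OF der[OF s(1)] _ _ refl])
      then show "\<not> s islimpt {t. x + t *\<^sub>R e \<in> B e}"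
        by (rule contrapos_nn) (auto elim!: islimpt_subset simp: B_def)
    qed
  qed
  then have "(\<Union>e\<in>Basis. B e) \<in> null_sets lborel"
    by (intro null_sets.finite_UN) auto
  moreover have "{x \<in> S. f x = 0} = (\<Union>e\<in>Basis. B e)"
    using assms(5) by (auto simp: B_def euclidean_eq_iff[of _ "0::'a"])
  ultimately show ?thesis by simp
qed

section \<open>Convex conjugation\<close>

definition epigraph :: "('a \<Rightarrow> ereal) \<Rightarrow> ('a \<times> real) set" where
  "epigraph F = {(z, t). F z \<le> ereal t}"

text \<open>
  Lower semicontinuity is phrased with the punctured limes inferior; the value at the point itself
  has to be put back to control sequences that may visit that point.
\<close>

lemma closed_epigraph:
  fixes F :: "'a::first_countable_topology \<Rightarrow> ereal"
  assumes "lsc F"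
  shows "closed (epigraph F)"
  unfolding closed_sequential_limits
proof (intro allI impI, elim conjE)
  fix X l assume X: "\<forall>n. X n \<in> epigraph F" and "X \<longlonglongrightarrow> l"
  obtain z t where l: "l = (z, t)" by (cases l)
  have z: "(\<lambda>n. fst (X n)) \<longlonglongrightarrow> z" and t: "(\<lambda>n. snd (X n)) \<longlonglongrightarrow> t"
    using tendsto_fst[OF \<open>X \<longlonglongrightarrow> l\<close>] tendsto_snd[OF \<open>X \<longlonglongrightarrow> l\<close>] by (simp_all add: l)
  show "l \<in> epigraph F"
  proof (rule ccontr)
    assume "l \<notin> epigraph F"
    then have "ereal t < F z" by (auto simp: l epigraph_def)
    then obtain r where r: "ereal t < ereal r" "ereal r < F z"
      using ereal_dense2 by blast
    from r(2) have "ereal r < Liminf (at z) F"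
      using assms unfolding lsc_def by (meson less_le_trans)
    then have "\<forall>\<^sub>F w in at z. ereal r < F w"
      by (rule less_LiminfD)
    with r(2) have "\<forall>\<^sub>F w in nhds z. ereal r < F w"
      by (auto simp: eventually_at_filter elim: eventually_mono)
    then have "\<forall>\<^sub>F n in sequentially. ereal r < F (fst (X n))"
      using z by (rule eventually_compose_filterlim)
    moreover have "\<forall>\<^sub>F n in sequentially. snd (X n) < r"
      using t r(1) by (intro order_tendstoD(2)) auto
    ultimately have "\<forall>\<^sub>F n in sequentially. False"
    proof eventually_elim
      case (elim n)
      have "F (fst (X n)) \<le> ereal (snd (X n))"
        using X[rule_format, of n] by (auto simp: epigraph_def split: prod.splits)
      also have "\<dots> < ereal r" using elim by simp
      finally show False using elim by simp
    qed
    then show False by simp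
  qed
qed

lemma convex_epigraph:
  assumes "ereal_convex F"
  shows "convex (epigraph F)"
  unfolding convex_alt
proof (intro ballI allI impI)
  fix p q and u :: real
  assume "p \<in> epigraph F" "q \<in> epigraph F" and u: "0 \<le> u \<and> u \<le> 1"
  then obtain x s z t where pq: "p = (x, s)" "q = (z, t)" and st: "F x \<le> ereal s" "F z \<le> ereal t"
    by (auto simp: epigraph_def)
  have "F ((1 - u) *\<^sub>R x + u *\<^sub>R z) \<le> ereal (1 - u) * F x + ereal u * F z"
    using assms u unfolding ereal_convex_def by simp
  also have "\<dots> \<le> ereal (1 - u) * ereal s + ereal u * ereal t"
    using u st by (intro add_mono ereal_mult_left_mono) auto
  finally show "(1 - u) *\<^sub>R p + u *\<^sub>R q \<in> epigraph F"
    by (simp add: pq epigraph_def)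
qed

lemma legendre_le_realI:
  assumes "\<And>z. ereal (\<psi> \<bullet> z - b) \<le> F z"
  shows "legendre F \<psi> \<le> ereal b"
  unfolding legendre_def
proof (rule SUP_least)
  fix z
  from assms[of z] show "ereal (\<psi> \<bullet> z) - F z \<le> ereal b"
    by (cases "F z") auto
qed

lemma fenchel_young:
  assumes "F z \<noteq> -\<infinity>" and "F z \<noteq> \<infinity> \<or> legendre F \<psi> \<noteq> -\<infinity>"
  shows "ereal (\<psi> \<bullet> z) \<le> F z + legendre F \<psi>"
proof -
  have "ereal (\<psi> \<bullet> z) - F z \<le> legendre F \<psi>"
    unfolding legendre_def by (rule SUP_upper) simp
  then show ?thesis using assms
    by (cases "F z"; cases "legendre F \<psi>") auto
qed

lemma legendre_neq_minus_infinity: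
  assumes "proper F"
  shows "legendre F \<psi> \<noteq> -\<infinity>"
proof -
  obtain z where "F z \<noteq> \<infinity>" using assms unfolding proper_def by blast
  moreover have "ereal (\<psi> \<bullet> z) - F z \<le> legendre F \<psi>"
    unfolding legendre_def by (rule SUP_upper) simp
  ultimately show ?thesis by (cases "F z") auto
qed

text \<open>
  The vertical coefficient \<open>s\<close> is nonnegative because the epigraph is unbounded upwards.
\<close>

lemma epigraph_separation:
  fixes F :: "'a::euclidean_space \<Rightarrow> ereal"
  assumes "lsc F" and "ereal_convex F" and "proper F" and F: "\<forall>l. F l \<noteq> -\<infinity>"
    and a: "ereal a < F m"
  obtains p s b where "s \<ge> 0" "p \<bullet> m + s * a < b"
    "\<And>z t. F z = ereal t \<Longrightarrow> b < p \<bullet> z + s * t"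
proof -
  have "(m, a) \<notin> epigraph F" using a by (auto simp: epigraph_def)
  then obtain q b where qb: "q \<bullet> (m, a) < b" "\<forall>x\<in>epigraph F. q \<bullet> x > b"
    using separating_hyperplane_closed_point[OF convex_epigraph closed_epigraph] assms by blast
  obtain p s where q: "q = (p, s)" by (cases q)
  have ep: "b < p \<bullet> z + s * t" if "F z \<le> ereal t" for z t
    using qb(2) that by (auto simp: epigraph_def q)
  have "s \<ge> 0"
  proof (rule ccontr)
    assume "\<not> s \<ge> 0"
    then have s: "s < 0" by simp
    obtain z t where zt: "F z = ereal t"
      using \<open>proper F\<close> F unfolding proper_def by (metis ereal_cases)
    \<comment> \<open>The height at which a downward slope \<open>s\<close> would push the epigraph below the hyperplane.\<close>
    define k where "k = max 0 ((b - p \<bullet> z - s * t) / s)"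
    have "b < p \<bullet> z + s * (t + k)"
      using zt by (intro ep) (auto simp: k_def)
    moreover have "s * k \<le> b - p \<bullet> z - s * t"
      using s mult_left_mono_neg[of "(b - p \<bullet> z - s * t) / s" k s] by (simp add: k_def)
    ultimately show False by (simp add: algebra_simps)
  qed
  moreover have "p \<bullet> m + s * a < b" using qb(1) by (simp add: q)
  moreover have "b < p \<bullet> z + s * t" if "F z = ereal t" for z t
    using ep[of z t] that by simp
  ultimately show ?thesis by (rule that)
qed

text \<open>
  A hyperplane below the epigraph that is not vertical is the graph of an affine minorant of \<open>F\<close>,
  and affine minorants of slope \<open>\<psi>\<close> are upper bounds of \<open>F\<^sup>* \<psi>\<close>.
\<close>

lemma legendre_bound_if_nonvertical:
  assumes s: "s > 0" and F: "\<forall>l. F l \<noteq> -\<infinity>"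
    and ep: "\<And>z t. F z = ereal t \<Longrightarrow> b < p \<bullet> z + s * t"
  shows "legendre F ((- 1 / s) *\<^sub>R p) \<le> ereal (- b / s)"
proof (rule legendre_le_realI)
  fix z
  show "ereal ((- 1 / s) *\<^sub>R p \<bullet> z - - b / s) \<le> F z"
  proof (cases "F z")
    case (real t)
    from ep[OF real] s have "(b - p \<bullet> z) / s < t"
      by (simp add: pos_divide_less_eq algebra_simps)
    then show ?thesis using real by (simp add: diff_divide_distrib)
  qed (use F in auto)
qed

text \<open>
  A point below the graph over a point of the effective domain cannot be separated from the epigraph
  by a vertical hyperplane.
\<close>

lemma legendre_finite_somewhere:
  fixes F :: "'a::euclidean_space \<Rightarrow> ereal"
  assumes "lsc F" and "ereal_convex F" and "proper F" and F: "\<forall>l. F l \<noteq> -\<infinity>"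
  obtains \<psi> r where "legendre F \<psi> = ereal r"
proof -
  obtain z t where zt: "F z = ereal t"
    using \<open>proper F\<close> F unfolding proper_def by (metis ereal_cases)
  then have "ereal (t - 1) < F z" by simp
  then obtain p s b where s: "s \<ge> 0" and *: "p \<bullet> z + s * (t - 1) < b"
    "\<And>z t. F z = ereal t \<Longrightarrow> b < p \<bullet> z + s * t"
    using epigraph_separation[OF assms, of "t - 1" z] by metis
  from *(1) *(2)[OF zt] have "p \<bullet> z + s * (t - 1) < p \<bullet> z + s * t" by linarith
  then have "s > 0" by (simp add: algebra_simps)
  then have "legendre F ((- 1 / s) *\<^sub>R p) \<le> ereal (- b / s)"
    using F *(2) by (intro legendre_bound_if_nonvertical) auto
  with legendre_neq_minus_infinity[OF \<open>proper F\<close>, of "(- 1 / s) *\<^sub>R p"] show ?thesis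
    by (cases "legendre F ((- 1 / s) *\<^sub>R p)") (auto intro: that)
qed

text \<open>
  This is the nontrivial half of \<open>F = F\<^sup>*\<^sup>*\<close>: every value below \<open>F m\<close> is exceeded by an affine
  minorant. The separating hyperplane is such a minorant unless it is vertical; a vertical one
  separates \<open>m\<close> from the effective domain, and then any affine minorant can be tilted along it until
  it is as large as desired at \<open>m\<close>.
\<close>

lemma fenchel_moreau:
  fixes F :: "'a::euclidean_space \<Rightarrow> ereal"
  assumes "lsc F" and "ereal_convex F" and "proper F" and F: "\<forall>l. F l \<noteq> -\<infinity>"
    and a: "ereal a < F m"
  obtains \<psi> r where "legendre F \<psi> = ereal r" "a < \<psi> \<bullet> m - r"
proof -
  obtain s p b where s: "s \<ge> 0" and sep: "p \<bullet> m + s * a < b"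
    and ep: "\<And>z t. F z = ereal t \<Longrightarrow> b < p \<bullet> z + s * t"
    using epigraph_separation[OF assms] by metis
  show ?thesis
  proof (cases "s = 0")
    case False
    with s have s: "s > 0" by simp
    define \<psi> where "\<psi> = (- 1 / s) *\<^sub>R p"
    have "legendre F \<psi> \<le> ereal (- b / s)"
      unfolding \<psi>_def using s F ep by (intro legendre_bound_if_nonvertical) auto
    with legendre_neq_minus_infinity[OF \<open>proper F\<close>, of \<psi>] obtain r
      where r: "legendre F \<psi> = ereal r" "r \<le> - b / s"
      by (cases "legendre F \<psi>") auto
    have "a < (b - p \<bullet> m) / s" using sep s by (simp add: pos_less_divide_eq algebra_simps)
    then have "a < \<psi> \<bullet> m - r" using r(2) by (simp add: \<psi>_def diff_divide_distrib)
    with r(1) show ?thesis by (rule that)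
  next
    case True
    obtain \<psi>0 r0 where r0: "legendre F \<psi>0 = ereal r0"
      using legendre_finite_somewhere assms by blast
    define d where "d = b - p \<bullet> m"
    have d: "d > 0" using sep True by (simp add: d_def)
    \<comment> \<open>The amount of tilting that lifts the minorant above \<open>a\<close> at \<open>m\<close>.\<close>
    define k where "k = (\<bar>a - (\<psi>0 \<bullet> m - r0)\<bar> + 1) / d"
    have k: "k \<ge> 0" "k * d > a - (\<psi>0 \<bullet> m - r0)" using d by (auto simp: k_def)
    define \<psi> where "\<psi> = \<psi>0 - k *\<^sub>R p"
    have "legendre F \<psi> \<le> ereal (r0 - k * b)"
    proof (rule legendre_le_realI)
      fix z
      show "ereal (\<psi> \<bullet> z - (r0 - k * b)) \<le> F z"
      proof (cases "F z")
        case (real t)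
        have "\<psi>0 \<bullet> z \<le> t + r0"
          using fenchel_young[of F z \<psi>0] real r0 by simp
        moreover have "k * b \<le> k * (p \<bullet> z)"
          using ep[OF real] True k(1) by (intro mult_left_mono) auto
        ultimately show ?thesis by (simp add: real \<psi>_def inner_diff_left)
      qed (use F in auto)
    qed
    with legendre_neq_minus_infinity[OF \<open>proper F\<close>, of \<psi>] obtain r
      where r: "legendre F \<psi> = ereal r" "r \<le> r0 - k * b"
      by (cases "legendre F \<psi>") auto
    have "a < \<psi> \<bullet> m - r"
      using k(2) r(2) by (simp add: \<psi>_def d_def algebra_simps inner_diff_left)
    with r(1) show ?thesis by (rule that)
  qed
qed

text \<open>
  Subgradients of \<open>F\<^sup>*\<close> are inverted: if \<open>m \<in> \<partial>F\<^sup>*(\<psi>)\<close>, then \<open>\<xi> \<mapsto> \<xi> \<bullet> m - F\<^sup>* \<xi>\<close> is largest at \<open>\<psi>\<close>,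
  and its supremum is \<open>F m\<close>. The hypothesis on \<open>m\<close> ranges only over points where \<open>F\<^sup>*\<close> is finite,
  because the subgradient inequality is trivial elsewhere.
\<close>

lemma subdifferential_if_conjugate_subgradient:
  fixes F :: "'a::euclidean_space \<Rightarrow> ereal"
  assumes "lsc F" and "ereal_convex F" and "proper F" and F: "\<forall>l. F l \<noteq> -\<infinity>"
    and r: "legendre F \<psi> = ereal r"
    and sub: "\<And>\<xi> s. legendre F \<xi> = ereal s \<Longrightarrow> r + (\<xi> - \<psi>) \<bullet> m \<le> s"
  shows "\<psi> \<in> subdifferential F m"
proof -
  have "F m \<le> ereal (\<psi> \<bullet> m - r)"
  proof (rule ccontr)
    assume "\<not> ?thesis"
    then have "ereal (\<psi> \<bullet> m - r) < F m" by simp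
    then obtain \<xi> s where s: "legendre F \<xi> = ereal s" "\<psi> \<bullet> m - r < \<xi> \<bullet> m - s"
      using fenchel_moreau assms(1-4) by blast
    with sub[OF s(1)] show False by (simp add: inner_diff_left)
  qed
  then have "F m + ereal ((z - m) \<bullet> \<psi>) \<le> F z" for z
    using fenchel_young[of F z \<psi>] F[rule_format, of m] F[rule_format, of z] r
    by (cases "F m"; cases "F z") (auto simp: inner_commute inner_diff_left inner_diff_right)
  then show ?thesis unfolding subdifferential_def by simp
qed

lemma subdifferential_iff_fenchel_equality:
  assumes "proper F" and F: "\<forall>l. F l \<noteq> -\<infinity>"
  shows "\<psi> \<in> subdifferential F l \<longleftrightarrow>
    (\<exists>u. F l = ereal u \<and> legendre F \<psi> = ereal (\<psi> \<bullet> l - u))"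
proof
  assume "\<psi> \<in> subdifferential F l"
  then have sub: "F z \<ge> F l + ereal ((z - l) \<bullet> \<psi>)" for z
    unfolding subdifferential_def by simp
  obtain z t where "F z = ereal t"
    using \<open>proper F\<close> F unfolding proper_def by (metis ereal_cases)
  with sub[of z] F[rule_format, of l] obtain u where u: "F l = ereal u"
    by (cases "F l") auto
  have "legendre F \<psi> \<le> ereal (\<psi> \<bullet> l - u)"
  proof (rule legendre_le_realI)
    fix z
    show "ereal (\<psi> \<bullet> z - (\<psi> \<bullet> l - u)) \<le> F z"
      using sub[of z] by (simp add: u inner_commute inner_diff_left inner_diff_right algebra_simps)
  qed
  with fenchel_young[of F l \<psi>] u
  show "\<exists>u. F l = ereal u \<and> legendre F \<psi> = ereal (\<psi> \<bullet> l - u)"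
    by (cases "legendre F \<psi>") auto
next
  assume "\<exists>u. F l = ereal u \<and> legendre F \<psi> = ereal (\<psi> \<bullet> l - u)"
  then obtain u where u: "F l = ereal u" "legendre F \<psi> = ereal (\<psi> \<bullet> l - u)" by blast
  have "F l + ereal ((z - l) \<bullet> \<psi>) \<le> F z" for z
    using fenchel_young[of F z \<psi>] F[rule_format, of z] u
    by (cases "F z") (auto simp: inner_commute inner_diff_left inner_diff_right)
  then show "\<psi> \<in> subdifferential F l" unfolding subdifferential_def by simp
qed

text \<open>
  Convexity of \<open>F\<^sup>*\<close> on the segment from \<open>\<psi>\<close> to \<open>\<xi>\<close>, with finiteness on the segment included.
\<close>

lemma legendre_convex_segment:
  assumes F: "\<forall>l. F l \<noteq> -\<infinity>" and p: "proper F"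
    and r: "legendre F \<psi> = ereal r" and s: "legendre F \<xi> = ereal s" and t: "0 \<le> t" "t \<le> 1"
  obtains u where "legendre F (\<psi> + t *\<^sub>R (\<xi> - \<psi>)) = ereal u" "u \<le> r + t * (s - r)"
proof -
  have "legendre F (\<psi> + t *\<^sub>R (\<xi> - \<psi>)) \<le> ereal (r + t * (s - r))"
  proof (rule legendre_le_realI)
    fix z
    show "ereal ((\<psi> + t *\<^sub>R (\<xi> - \<psi>)) \<bullet> z - (r + t * (s - r))) \<le> F z"
    proof (cases "F z")
      case (real v)
      have "\<psi> \<bullet> z - r \<le> v" "\<xi> \<bullet> z - s \<le> v"
        using fenchel_young[of F z \<psi>] fenchel_young[of F z \<xi>] real r s by auto
      then have "(1 - t) * (\<psi> \<bullet> z - r) + t * (\<xi> \<bullet> z - s) \<le> (1 - t) * v + t * v"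
        using t by (intro add_mono mult_left_mono) auto
      then show ?thesis
        by (simp add: real inner_add_left inner_diff_left algebra_simps)
    qed (use F in auto)
  qed
  with legendre_neq_minus_infinity[OF p, of "\<psi> + t *\<^sub>R (\<xi> - \<psi>)"] show ?thesis
    by (cases "legendre F (\<psi> + t *\<^sub>R (\<xi> - \<psi>))") (auto intro: that)
qed

section \<open>Maxima of continuous functions and discrete measures\<close>

lemma continuous_on_Max_finite:
  fixes f :: "'i \<Rightarrow> 'a::topological_space \<Rightarrow> 'b::linorder_topology"
  assumes "finite A" and "A \<noteq> {}" and "\<And>j. j \<in> A \<Longrightarrow> continuous_on S (f j)"
  shows "continuous_on S (\<lambda>x. Max ((\<lambda>j. f j x) ` A))"
  using assms
proof (induction A rule: finite_ne_induct)
  case (insert a A)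
  then have "continuous_on S (\<lambda>x. max (f a x) (Max ((\<lambda>j. f j x) ` A)))"
    by (intro continuous_on_max) auto
  with insert show ?case by simp
qed simp

lemma sets_borel_on_finite:
  fixes S :: "'a::t1_space set"
  assumes "finite S"
  shows "sets (borel_on S) = Pow S"
proof -
  have "A \<in> (\<inter>) S ` sets borel" if "A \<subseteq> S" for A
  proof
    show "A = S \<inter> A" using that by blast
    show "A \<in> sets borel"
      using that assms by (intro borel_closed finite_imp_closed) (rule finite_subset)
  qed
  then show ?thesis by (auto simp: sets_restrict_space)
qed

lemma nu_discrete:
  fixes y :: "'m::finite \<Rightarrow> real^'n"
  shows space_nu: "space (nu y l) = range y"
    and sets_nu: "sets (nu y l) = Pow (range y)"
    and emeasure_nu: "A \<subseteq> range y \<Longrightarrow>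
      emeasure (nu y l) A = (\<Sum>j\<in>UNIV. ennreal (l $ j) * indicator A (y j))"
proof -
  have fin: "sets (borel_on (range y)) = Pow (range y)"
    by (simp add: sets_borel_on_finite)
  show "space (nu y l) = range y"
    unfolding nu_def fin by (simp add: space_measure_of)
  show s: "sets (nu y l) = Pow (range y)"
    unfolding nu_def fin by (simp add: sets_measure_of sigma_algebra.sigma_sets_eq[OF sigma_algebra_Pow])
  show "emeasure (nu y l) A = (\<Sum>j\<in>UNIV. ennreal (l $ j) * indicator A (y j))"
    if "A \<subseteq> range y"
  proof (rule emeasure_measure_of[OF nu_def])
    show "sets (borel_on (range y)) \<subseteq> Pow (range y)" by (simp add: fin)
    show "A \<in> sets (nu y l)" using that s by simp
    show "positive (sets (nu y l)) (\<lambda>A. \<Sum>j\<in>UNIV. ennreal (l $ j) * indicator A (y j))"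
      by (simp add: positive_def)
    show "countably_additive (sets (nu y l)) (\<lambda>A. \<Sum>j\<in>UNIV. ennreal (l $ j) * indicator A (y j))"
    proof (rule countably_additiveI)
      fix B :: "nat \<Rightarrow> (real^'n) set" assume "disjoint_family B"
      have "(\<Sum>i. \<Sum>j\<in>UNIV. ennreal (l $ j) * indicator (B i) (y j))
          = (\<Sum>j\<in>UNIV. \<Sum>i. ennreal (l $ j) * indicator (B i) (y j))"
        by (rule suminf_sum) auto
      also have "\<dots> = (\<Sum>j\<in>UNIV. ennreal (l $ j) * indicator (\<Union>i. B i) (y j))"
        using \<open>disjoint_family B\<close> by (simp add: suminf_indicator ennreal_suminf_cmult)
      finally show "(\<Sum>i. \<Sum>j\<in>UNIV. ennreal (l $ j) * indicator (B i) (y j))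
          = (\<Sum>j\<in>UNIV. ennreal (l $ j) * indicator (\<Union>i. B i) (y j))" .
    qed
  qed
qed

section \<open>Cells, couplings and slack\<close>

text \<open>
  Absolute continuity and the twist condition enter the transport argument only through \<open>no_ties\<close>,
  the statement that the indifference sets between two targets are null.
\<close>

locale semidiscrete =
  fixes X :: "(real^'n) set" and y :: "'m::finite \<Rightarrow> real^'n"
    and \<mu> :: "(real^'n) measure" and c :: "(real^'n) \<times> (real^'n) \<Rightarrow> real"
  assumes inj_y: "inj y" and compact_X: "compact X" and prob_\<mu>: "prob_space \<mu>"
    and sets_\<mu>: "sets \<mu> = sets (borel_on X)"
    and cont_c: "continuous_on (X \<times> range y) c"
    and no_ties: "\<And>j k t. j \<noteq> k \<Longrightarrow> AE x in \<mu>. c (x, y j) - c (x, y k) \<noteq> t"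
begin

sublocale prob_space \<mu> by (rule prob_\<mu>)

abbreviation cs :: "real^'m \<Rightarrow> real^'n \<Rightarrow> real" where
  "cs \<equiv> cstar_transform y c"

definition cell :: "real^'m \<Rightarrow> 'm \<Rightarrow> (real^'n) set" where
  "cell \<psi> j = {x \<in> X. - c (x, y j) - \<psi> $ j = cs \<psi> x}"

definition cell_masses :: "real^'m \<Rightarrow> real^'m" where
  "cell_masses \<psi> = (\<chi> j. measure \<mu> (cell \<psi> j))"

text \<open>
  The slack in the dual constraint for the pair \<open>(\<psi>\<^sup>c\<^sup>*, \<psi>)\<close>. The index of a target is recovered by
  \<open>inv y\<close>, so that the slack is a function on \<open>X \<times> Y\<close> and can be integrated against couplings.
\<close>

definition slack :: "real^'m \<Rightarrow> (real^'n) \<times> (real^'n) \<Rightarrow> real" where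
  "slack \<psi> z = c z + cs \<psi> (fst z) + \<psi> $ inv y (snd z)"

lemma space_\<mu>: "space \<mu> = X"
  using sets_eq_imp_space_eq[OF sets_\<mu>] by (simp add: space_restrict_space)

lemma measurable_on_X: "continuous_on X f \<Longrightarrow> f \<in> borel_measurable \<mu>"
  for f :: "real^'n \<Rightarrow> real"
  using borel_measurable_continuous_on_restrict measurable_cong_sets[OF sets_\<mu> refl] by blast

lemma bounded_on_X:
  fixes f :: "real^'n \<Rightarrow> real"
  assumes "continuous_on X f"
  obtains B where "\<And>x. x \<in> X \<Longrightarrow> \<bar>f x\<bar> \<le> B"
proof -
  have "bounded (f ` X)"
    using compact_continuous_image[OF assms compact_X] by (rule compact_imp_bounded)
  then show ?thesis using that by (auto simp: bounded_iff)
qed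

lemma integrable_on_X:
  fixes f :: "real^'n \<Rightarrow> real"
  assumes "continuous_on X f"
  shows "integrable \<mu> f"
proof -
  obtain B where "\<And>x. x \<in> X \<Longrightarrow> \<bar>f x\<bar> \<le> B" using bounded_on_X[OF assms] by metis
  then show ?thesis
    using measurable_on_X[OF assms] by (intro integrable_const_bound[of _ B]) (auto simp: space_\<mu>)
qed

lemma continuous_cost: "continuous_on X (\<lambda>x. c (x, y j))"
  by (rule continuous_on_compose2[OF cont_c]) (auto intro!: continuous_intros)

lemma cs_ge: "- c (x, y j) - \<psi> $ j \<le> cs \<psi> x"
  unfolding cstar_transform_def by (intro Max_ge) auto

lemma cs_le_iff: "cs \<psi> x \<le> b \<longleftrightarrow> (\<forall>j. - c (x, y j) - \<psi> $ j \<le> b)"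
  unfolding cstar_transform_def by (subst Max_le_iff) auto

lemma cs_attained: obtains j where "- c (x, y j) - \<psi> $ j = cs \<psi> x"
proof -
  have "cs \<psi> x \<in> range (\<lambda>j. - c (x, y j) - \<psi> $ j)"
    unfolding cstar_transform_def by (intro Max_in) auto
  then show ?thesis using that by auto
qed

lemma continuous_cs: "continuous_on X (cs \<psi>)"
  unfolding cstar_transform_def
  by (rule continuous_on_Max_finite) (auto intro!: continuous_intros continuous_cost)

lemma cell_sets: "cell \<psi> j \<in> sets \<mu>"
proof -
  have [measurable]: "(\<lambda>x. - c (x, y j) - \<psi> $ j) \<in> borel_measurable \<mu>" "cs \<psi> \<in> borel_measurable \<mu>"
    by (auto intro!: measurable_on_X continuous_cs continuous_intros continuous_cost)
  have "{x \<in> space \<mu>. - c (x, y j) - \<psi> $ j = cs \<psi> x} \<in> sets \<mu>" by measurable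
  then show ?thesis by (simp add: cell_def space_\<mu>)
qed

lemma AE_in_unique_cell: "AE x in \<mu>. \<exists>!j. x \<in> cell \<psi> j"
proof -
  have "AE x in \<mu>. \<forall>j k. j \<noteq> k \<longrightarrow> c (x, y j) - c (x, y k) \<noteq> \<psi> $ k - \<psi> $ j"
    using no_ties by (simp add: AE_all_countable AE_impI)
  then show ?thesis using AE_space
  proof eventually_elim
    case (elim x)
    obtain j where "- c (x, y j) - \<psi> $ j = cs \<psi> x" by (rule cs_attained)
    moreover have "k = i" if "- c (x, y k) - \<psi> $ k = cs \<psi> x" "- c (x, y i) - \<psi> $ i = cs \<psi> x" for i k
      using elim(1)[rule_format, of k i] that by (cases "k = i") auto
    ultimately show ?case using elim(2) by (auto simp: cell_def space_\<mu>)
  qed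
qed

lemma integral_cellwise_constant:
  shows "integrable \<mu> (\<lambda>x. \<Sum>j\<in>UNIV. indicator (cell \<psi> j) x * h $ j)"
    and "(\<integral>x. (\<Sum>j\<in>UNIV. indicator (cell \<psi> j) x * h $ j) \<partial>\<mu>) = cell_masses \<psi> \<bullet> h"
proof -
  have i: "integrable \<mu> (\<lambda>x. indicator (cell \<psi> j) x * h $ j)" for j
    using cell_sets by (intro integrable_mult_left) (auto simp: emeasure_eq_measure)
  then show "integrable \<mu> (\<lambda>x. \<Sum>j\<in>UNIV. indicator (cell \<psi> j) x * h $ j)"
    by (rule Bochner_Integration.integrable_sum)
  show "(\<integral>x. (\<Sum>j\<in>UNIV. indicator (cell \<psi> j) x * h $ j) \<partial>\<mu>) = cell_masses \<psi> \<bullet> h"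
    by (subst Bochner_Integration.integral_sum[OF i])
      (simp add: inner_vec_def cell_masses_def Int_absorb2 sets.sets_into_space[OF cell_sets])
qed

lemma sum_indicator_unique_cell:
  assumes "\<exists>!j. x \<in> cell \<psi> j" and "x \<in> cell \<psi> k"
  shows "(\<Sum>j\<in>UNIV. indicator (cell \<psi> j) x * (h :: real^'m) $ j) = h $ k"
proof -
  have "(\<Sum>j\<in>UNIV. indicator (cell \<psi> j) x * h $ j) = (\<Sum>j\<in>UNIV. if j = k then h $ j else 0)"
    using assms by (intro sum.cong) (auto simp: indicator_def)
  then show ?thesis by simp
qed

lemma cell_masses_simplex: "cell_masses \<psi> \<in> simplex_weights"
proof -
  have "AE x in \<mu>. (\<Sum>j\<in>UNIV. indicator (cell \<psi> j) x * (1 :: real^'m) $ j) = 1"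
    using AE_in_unique_cell[of \<psi>]
  proof eventually_elim
    case (elim x)
    then obtain k where "x \<in> cell \<psi> k" by blast
    from sum_indicator_unique_cell[OF elim this, of 1] show ?case by simp
  qed
  then have "(\<integral>x. (\<Sum>j\<in>UNIV. indicator (cell \<psi> j) x * (1 :: real^'m) $ j) \<partial>\<mu>) = (\<integral>x. 1 \<partial>\<mu>)"
    using integral_cellwise_constant(1)[of \<psi> 1] by (intro integral_cong_AE) auto
  then have "cell_masses \<psi> \<bullet> 1 = 1"
    unfolding integral_cellwise_constant(2) by (simp add: prob_space)
  then show ?thesis by (simp add: simplex_weights_def cell_masses_def inner_vec_def)
qed

lemma cs_increment_bound: "\<bar>cs (\<psi> + h) x - cs \<psi> x\<bar> \<le> norm h"
proof -
  have h: "\<bar>h $ j\<bar> \<le> norm h" for j by (rule component_le_norm_cart)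
  have "cs (\<psi> + h) x \<le> cs \<psi> x + norm h"
    unfolding cs_le_iff
  proof
    fix j show "- c (x, y j) - (\<psi> + h) $ j \<le> cs \<psi> x + norm h"
      using h[of j] cs_ge[of x j \<psi>] by simp
  qed
  moreover have "cs \<psi> x \<le> cs (\<psi> + h) x + norm h"
    unfolding cs_le_iff
  proof
    fix j show "- c (x, y j) - \<psi> $ j \<le> cs (\<psi> + h) x + norm h"
      using h[of j] cs_ge[of x j "\<psi> + h"] by simp
  qed
  ultimately show ?thesis by linarith
qed

text \<open>
  If only \<open>j\<close> attains the maximum, the other finitely many candidates stay behind by a positive gap,
  which a small perturbation of \<open>\<psi>\<close> cannot close; so \<open>j\<close> remains the maximizer.
\<close>

lemma cs_difference_quotient_eventually:
  assumes uniq: "\<exists>!j. x \<in> cell \<psi> j" and j: "x \<in> cell \<psi> j"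
  shows "\<forall>\<^sub>F t in at_right 0. (cs (\<psi> + t *\<^sub>R h) x - cs \<psi> x) / t = - h $ j"
proof -
  have gap: "0 < cs \<psi> x - (- c (x, y i) - \<psi> $ i)" if "i \<noteq> j" for i
    using uniq j that cs_ge[of x i \<psi>] unfolding cell_def by fastforce
  have "\<forall>\<^sub>F t in at_right 0. \<forall>i\<in>UNIV - {j}. t * (2 * norm h) < cs \<psi> x - (- c (x, y i) - \<psi> $ i)"
  proof (rule eventually_ball_finite, simp, intro ballI)
    fix i assume "i \<in> UNIV - {j}"
    then have g: "0 < cs \<psi> x - (- c (x, y i) - \<psi> $ i)" using gap by blast
    have "((\<lambda>t. t * (2 * norm h)) \<longlongrightarrow> 0 * (2 * norm h)) (at_right 0)"
      by (intro tendsto_intros)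
    then show "\<forall>\<^sub>F t in at_right 0. t * (2 * norm h) < cs \<psi> x - (- c (x, y i) - \<psi> $ i)"
      using g by (intro order_tendstoD(2)) auto
  qed
  moreover have "\<forall>\<^sub>F t in at_right 0. (0::real) < t" by (simp add: eventually_at_right_less)
  ultimately show ?thesis
  proof eventually_elim
    case (elim t)
    have h: "\<bar>t * h $ i\<bar> \<le> t * norm h" for i
      using component_le_norm_cart[of h i] elim(2) by (simp add: abs_mult)
    have cj: "- c (x, y j) - \<psi> $ j = cs \<psi> x" using j by (simp add: cell_def)
    have "cs (\<psi> + t *\<^sub>R h) x \<le> cs \<psi> x - t * h $ j"
      unfolding cs_le_iff
    proof
      fix i
      show "- c (x, y i) - (\<psi> + t *\<^sub>R h) $ i \<le> cs \<psi> x - t * h $ j"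
      proof (cases "i = j")
        case True then show ?thesis using cj by simp
      next
        case False
        with elim(1) have "t * (2 * norm h) < cs \<psi> x - (- c (x, y i) - \<psi> $ i)" by blast
        with h[of i] h[of j] show ?thesis by (simp add: abs_le_iff)
      qed
    qed
    moreover have "cs \<psi> x - t * h $ j \<le> cs (\<psi> + t *\<^sub>R h) x"
      using cs_ge[of x j "\<psi> + t *\<^sub>R h"] cj by simp
    ultimately show ?case using elim(2) by (simp add: field_simps)
  qed
qed

text \<open>
  The gradient of \<open>H\<close> is minus the vector of cell masses. The difference quotients are uniformly
  bounded, since \<open>\<psi> \<mapsto> \<psi>\<^sup>c\<^sup>* x\<close> is 1-Lipschitz, and they converge wherever the cell is unique.
\<close>

lemma integral_cs_directional_derivative:
  "(\<lambda>n. ((\<integral>x. cs (\<psi> + inverse (real (Suc n)) *\<^sub>R h) x \<partial>\<mu>) - (\<integral>x. cs \<psi> x \<partial>\<mu>)) / inverse (real (Suc n)))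
     \<longlonglongrightarrow> - (cell_masses \<psi> \<bullet> h)"
proof -
  define t where "t n = inverse (real (Suc n))" for n
  have t: "t n > 0" for n by (simp add: t_def)
  have t0: "filterlim t (at_right 0) sequentially"
    unfolding filterlim_at using t LIMSEQ_inverse_real_of_nat
    by (auto simp: t_def[abs_def])
  define q where "q n x = (cs (\<psi> + t n *\<^sub>R h) x - cs \<psi> x) / t n" for n x
  have cont_q: "continuous_on X (q n)" for n
    unfolding q_def using t[of n] by (intro continuous_intros continuous_cs) auto
  have "(\<lambda>n. \<integral>x. q n x \<partial>\<mu>) \<longlonglongrightarrow> (\<integral>x. (\<Sum>j\<in>UNIV. indicator (cell \<psi> j) x * (- h) $ j) \<partial>\<mu>)"
  proof (rule integral_dominated_convergence[where w = "\<lambda>_. norm h"])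
    show "(\<lambda>x. \<Sum>j\<in>UNIV. indicator (cell \<psi> j) x * (- h) $ j) \<in> borel_measurable \<mu>"
      using integral_cellwise_constant(1)[of \<psi> "- h"] by (rule borel_measurable_integrable)
    show "q n \<in> borel_measurable \<mu>" for n using cont_q by (rule measurable_on_X)
    show "integrable \<mu> (\<lambda>_. norm h)" by simp
    show "AE x in \<mu>. (\<lambda>n. q n x) \<longlonglongrightarrow> (\<Sum>j\<in>UNIV. indicator (cell \<psi> j) x * (- h) $ j)"
      using AE_in_unique_cell[of \<psi>]
    proof eventually_elim
      case (elim x)
      then obtain k where k: "x \<in> cell \<psi> k" by blast
      have "\<forall>\<^sub>F n in sequentially. q n x = - h $ k"
        using eventually_compose_filterlim[OF cs_difference_quotient_eventually[OF elim k, of h] t0]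
        by (simp add: q_def)
      then have "(\<lambda>n. q n x) \<longlonglongrightarrow> - h $ k" by (rule tendsto_eventually)
      then show ?case using sum_indicator_unique_cell[OF elim k, of "- h"] by simp
    qed
    show "AE x in \<mu>. norm (q n x) \<le> norm h" for n
    proof (rule AE_I2)
      fix x
      have "\<bar>cs (\<psi> + t n *\<^sub>R h) x - cs \<psi> x\<bar> \<le> t n * norm h"
        using cs_increment_bound[of \<psi> "t n *\<^sub>R h" x] t[of n] by simp
      then show "norm (q n x) \<le> norm h" using t[of n] by (simp add: q_def field_simps)
    qed
  qed
  moreover have "(\<integral>x. q n x \<partial>\<mu>) = ((\<integral>x. cs (\<psi> + t n *\<^sub>R h) x \<partial>\<mu>) - (\<integral>x. cs \<psi> x \<partial>\<mu>)) / t n" for n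
    unfolding q_def by (simp add: integrable_on_X[OF continuous_cs])
  moreover have "(\<integral>x. (\<Sum>j\<in>UNIV. indicator (cell \<psi> j) x * (- h) $ j) \<partial>\<mu>) = - (cell_masses \<psi> \<bullet> h)"
    by (subst integral_cellwise_constant) simp
  ultimately show ?thesis by (simp add: t_def)
qed

lemma coupling_facts:
  assumes g: "\<gamma> \<in> couplings \<mu> (nu y l)"
  shows coupling_space: "space \<gamma> = X \<times> range y"
    and coupling_prob: "prob_space \<gamma>"
    and coupling_fst: "fst \<in> \<gamma> \<rightarrow>\<^sub>M \<mu>" "distr \<gamma> \<mu> fst = \<mu>"
    and coupling_snd: "snd \<in> \<gamma> \<rightarrow>\<^sub>M nu y l" "distr \<gamma> (nu y l) snd = nu y l"
proof -
  have s: "sets \<gamma> = sets (\<mu> \<Otimes>\<^sub>M nu y l)" using g by (simp add: couplings_def)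
  show "space \<gamma> = X \<times> range y"
    using sets_eq_imp_space_eq[OF s] by (simp add: space_pair_measure space_\<mu> space_nu)
  show "prob_space \<gamma>" "distr \<gamma> \<mu> fst = \<mu>" "distr \<gamma> (nu y l) snd = nu y l"
    using g by (auto simp: couplings_def)
  show "fst \<in> \<gamma> \<rightarrow>\<^sub>M \<mu>" "snd \<in> \<gamma> \<rightarrow>\<^sub>M nu y l"
    by (auto simp: measurable_cong_sets[OF s refl])
qed

lemma coupling_integral_fst:
  fixes f :: "real^'n \<Rightarrow> real"
  assumes g: "\<gamma> \<in> couplings \<mu> (nu y l)" and f: "continuous_on X f"
  shows "integrable \<gamma> (\<lambda>z. f (fst z))" and "(\<integral>z. f (fst z) \<partial>\<gamma>) = (\<integral>x. f x \<partial>\<mu>)"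
proof -
  have i: "integrable (distr \<gamma> \<mu> fst) f"
    using integrable_on_X[OF f] by (simp add: coupling_fst(2)[OF g])
  show "integrable \<gamma> (\<lambda>z. f (fst z))"
    using integrable_distr[OF coupling_fst(1)[OF g] i] .
  show "(\<integral>z. f (fst z) \<partial>\<gamma>) = (\<integral>x. f x \<partial>\<mu>)"
    using integral_distr[OF coupling_fst(1)[OF g] measurable_on_X[OF f]]
    by (simp add: coupling_fst(2)[OF g])
qed

text \<open>
  The columns partition \<open>X \<times> Y\<close>. Integrals of functions of \<open>(x, y\<^sub>j)\<close> are computed column by
  column, which also yields measurability of \<open>c\<close> from continuity in \<open>x\<close> alone.
\<close>

definition column :: "'m \<Rightarrow> ((real^'n) \<times> (real^'n)) set" where
  "column j = X \<times> {y j}"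

lemma column_mass:
  assumes g: "\<gamma> \<in> couplings \<mu> (nu y l)" and l: "l \<in> simplex_weights"
  shows "column j \<in> sets \<gamma>" and "measure \<gamma> (column j) = l $ j"
proof -
  have eq: "column j = snd -` {y j} \<inter> space \<gamma>"
    by (auto simp: column_def coupling_space[OF g])
  have y: "{y j} \<in> sets (nu y l)" by (simp add: sets_nu)
  show "column j \<in> sets \<gamma>"
    unfolding eq using coupling_snd(1)[OF g] y by (rule measurable_sets)
  have "emeasure \<gamma> (column j) = emeasure (distr \<gamma> (nu y l) snd) {y j}"
    unfolding eq using coupling_snd(1)[OF g] y by (simp add: emeasure_distr)
  also have "\<dots> = (\<Sum>i\<in>UNIV. ennreal (l $ i) * indicator {y j} (y i))"
    unfolding coupling_snd(2)[OF g] by (rule emeasure_nu) simp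
  also have "\<dots> = (\<Sum>i\<in>UNIV. if i = j then ennreal (l $ i) else 0)"
    using inj_y by (intro sum.cong) (auto simp: indicator_def inj_eq)
  finally have "emeasure \<gamma> (column j) = ennreal (l $ j)" by simp
  then show "measure \<gamma> (column j) = l $ j"
    using l by (simp add: measure_def simplex_weights_def)
qed

lemma sum_over_columns:
  assumes "z \<in> X \<times> range y"
  shows "(\<Sum>j\<in>UNIV. indicator (column j) z * f j) = (f (inv y (snd z)) :: real)"
proof -
  obtain x k where z: "z = (x, y k)" "x \<in> X" using assms by auto
  have "(\<Sum>j\<in>UNIV. indicator (column j) z * f j) = (\<Sum>j\<in>UNIV. if j = k then f j else 0)"
    using z inj_y by (intro sum.cong) (auto simp: indicator_def column_def inj_eq)
  then show ?thesis using z inj_y by simp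
qed

lemma coupling_integral_snd:
  assumes g: "\<gamma> \<in> couplings \<mu> (nu y l)" and l: "l \<in> simplex_weights"
  shows "integrable \<gamma> (\<lambda>z. \<psi> $ inv y (snd z))" and "(\<integral>z. \<psi> $ inv y (snd z) \<partial>\<gamma>) = \<psi> \<bullet> l"
proof -
  interpret G: prob_space \<gamma> using g by (rule coupling_prob)
  have i: "integrable \<gamma> (\<lambda>z. indicator (column j) z * \<psi> $ j)" for j
    using column_mass(1)[OF g l] by (intro integrable_mult_left) (auto simp: G.emeasure_eq_measure)
  have eq: "\<psi> $ inv y (snd z) = (\<Sum>j\<in>UNIV. indicator (column j) z * \<psi> $ j)" if "z \<in> space \<gamma>" for z
    using sum_over_columns[of z "\<lambda>j. \<psi> $ j"] that coupling_space[OF g] by simp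
  show "integrable \<gamma> (\<lambda>z. \<psi> $ inv y (snd z))"
    by (rule iffD2[OF Bochner_Integration.integrable_cong[OF refl eq]])
      (assumption | rule Bochner_Integration.integrable_sum i)+
  have "(\<integral>z. \<psi> $ inv y (snd z) \<partial>\<gamma>) = (\<integral>z. (\<Sum>j\<in>UNIV. indicator (column j) z * \<psi> $ j) \<partial>\<gamma>)"
    by (rule Bochner_Integration.integral_cong[OF refl eq])
  also have "\<dots> = \<psi> \<bullet> l"
    by (subst Bochner_Integration.integral_sum[OF i])
      (simp add: inner_vec_def Int_absorb2 sets.sets_into_space[OF column_mass(1)[OF g l]]
        column_mass(2)[OF g l] mult.commute)
  finally show "(\<integral>z. \<psi> $ inv y (snd z) \<partial>\<gamma>) = \<psi> \<bullet> l" .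
qed

lemma coupling_integrable_cost:
  assumes g: "\<gamma> \<in> couplings \<mu> (nu y l)" and l: "l \<in> simplex_weights"
  shows "integrable \<gamma> c"
proof -
  have i: "integrable \<gamma> (\<lambda>z. indicator (column j) z * c (fst z, y j))" for j
    using integrable_mult_indicator[OF column_mass(1)[OF g l]
        coupling_integral_fst(1)[OF g continuous_cost]] by simp
  have eq: "c z = (\<Sum>j\<in>UNIV. indicator (column j) z * c (fst z, y j))" if "z \<in> space \<gamma>" for z
    using sum_over_columns[of z "\<lambda>j. c (fst z, y j)"] that coupling_space[OF g]
    by (auto simp: inj_y)
  show ?thesis
    by (rule iffD2[OF Bochner_Integration.integrable_cong[OF refl eq]])
      (assumption | rule Bochner_Integration.integrable_sum i)+
qed

text \<open>
  The marginal constraints fix the integrals of \<open>\<psi>\<^sup>c\<^sup>*\<close> and of \<open>\<psi>\<^sup>j\<close>, so the cost of a coupling is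
  its slack integral up to a term that depends on the marginals only.
\<close>

lemma cost_via_slack:
  assumes g: "\<gamma> \<in> couplings \<mu> (nu y l)" and l: "l \<in> simplex_weights"
  shows "integrable \<gamma> (slack \<psi>)"
    and "(\<integral>z. c z \<partial>\<gamma>) = (\<integral>z. slack \<psi> z \<partial>\<gamma>) - (\<integral>x. cs \<psi> x \<partial>\<mu>) - \<psi> \<bullet> l"
proof -
  note i = coupling_integrable_cost[OF g l] coupling_integral_fst[OF g continuous_cs[of \<psi>]]
    coupling_integral_snd[OF g l, of \<psi>]
  show "integrable \<gamma> (slack \<psi>)"
    unfolding slack_def using i by (intro Bochner_Integration.integrable_add)
  show "(\<integral>z. c z \<partial>\<gamma>) = (\<integral>z. slack \<psi> z \<partial>\<gamma>) - (\<integral>x. cs \<psi> x \<partial>\<mu>) - \<psi> \<bullet> l"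
    unfolding slack_def using i by simp
qed

lemma slack_nonneg: "z \<in> X \<times> range y \<Longrightarrow> 0 \<le> slack \<psi> z"
  using cs_ge[of "fst z" "inv y (snd z)" \<psi>] inj_y by (auto simp: slack_def)

lemma slack_zero_iff: "x \<in> X \<Longrightarrow> slack \<psi> (x, y j) = 0 \<longleftrightarrow> x \<in> cell \<psi> j"
  using inj_y by (auto simp: slack_def cell_def)

lemma integral_slack_nonneg:
  assumes "\<gamma> \<in> couplings \<mu> (nu y l)"
  shows "0 \<le> (\<integral>z. slack \<psi> z \<partial>\<gamma>)"
  using assms by (intro integral_nonneg_AE AE_I2 slack_nonneg) (simp add: coupling_space)

text \<open>
  A coupling with zero slack moves mass to \<open>y\<^sub>j\<close> only from the cell of \<open>j\<close>, so \<open>l\<^sup>j\<close> is at most the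
  mass of that cell. Both families sum to one, hence all these inequalities are equalities.
\<close>

lemma cell_masses_eq_if_slack_zero:
  assumes g: "\<gamma> \<in> couplings \<mu> (nu y l)" and l: "l \<in> simplex_weights"
    and slack: "(\<integral>z. slack \<psi> z \<partial>\<gamma>) = 0"
  shows "l = cell_masses \<psi>"
proof -
  interpret G: prob_space \<gamma> using g by (rule coupling_prob)
  have AE: "AE z in \<gamma>. slack \<psi> z = 0"
    using slack cost_via_slack(1)[OF g l, of \<psi>] slack_nonneg
    by (subst (asm) integral_nonneg_eq_0_iff_AE) (auto simp: coupling_space[OF g])
  have le: "l $ j \<le> cell_masses \<psi> $ j" for j
  proof -
    have m: "fst -` cell \<psi> j \<inter> space \<gamma> \<in> sets \<gamma>"
      using coupling_fst(1)[OF g] cell_sets by (rule measurable_sets)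
    have "AE z in \<gamma>. z \<in> column j \<longrightarrow> z \<in> fst -` cell \<psi> j \<inter> space \<gamma>"
      using AE AE_space
    proof eventually_elim
      case (elim z)
      then show ?case
        by (auto simp: column_def coupling_space[OF g] slack_zero_iff)
    qed
    then have "measure \<gamma> (column j) \<le> measure \<gamma> (fst -` cell \<psi> j \<inter> space \<gamma>)"
      using m by (rule G.finite_measure_mono_AE)
    also have "\<dots> = measure (distr \<gamma> \<mu> fst) (cell \<psi> j)"
      using coupling_fst(1)[OF g] cell_sets by (simp add: measure_distr)
    finally show ?thesis
      by (simp add: column_mass[OF g l] coupling_fst(2)[OF g] cell_masses_def)
  qed
  have "(\<Sum>j\<in>UNIV. cell_masses \<psi> $ j - l $ j) = 0"
    using l cell_masses_simplex[of \<psi>] by (simp add: simplex_weights_def sum_subtractf)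
  then have "\<forall>j\<in>UNIV. cell_masses \<psi> $ j - l $ j = 0"
    using le by (subst (asm) sum_nonneg_eq_0_iff) auto
  then show ?thesis by (simp add: vec_eq_iff)
qed

lemma transport_map_in_cell:
  assumes "\<exists>!j. x \<in> cell \<psi> j" and "x \<in> cell \<psi> j"
  shows "transport_map y c \<psi> x = y j"
proof -
  have "(THE j. cs \<psi> x = - c (x, y j) - \<psi> $ j) = j"
  proof (rule the_equality)
    show "cs \<psi> x = - c (x, y j) - \<psi> $ j" using assms(2) by (simp add: cell_def)
    fix k assume "cs \<psi> x = - c (x, y k) - \<psi> $ k"
    then have "x \<in> cell \<psi> k" using assms(2) by (simp add: cell_def)
    then show "k = j" using assms by blast
  qed
  then show ?thesis by (simp add: transport_map_def)
qed

text \<open>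
  The map factors through the set of maximizing indices, which takes finitely many values.
\<close>

lemma measurable_transport_map:
  "transport_map y c \<psi> \<in> \<mu> \<rightarrow>\<^sub>M count_space (range y)"
proof -
  define A where "A x = {j. x \<in> cell \<psi> j}" for x
  have "A \<in> \<mu> \<rightarrow>\<^sub>M count_space UNIV"
  proof (subst measurable_count_space_eq2, simp, intro conjI ballI)
    fix S :: "'m set"
    have "A -` {S} \<inter> space \<mu> = {x \<in> space \<mu>. \<forall>j. x \<in> cell \<psi> j \<longleftrightarrow> j \<in> S}"
      by (auto simp: A_def)
    also have "\<dots> \<in> sets \<mu>" using cell_sets by measurable
    finally show "A -` {S} \<inter> space \<mu> \<in> sets \<mu>" .
  qed simp
  then have "(\<lambda>x. y (THE j. j \<in> A x)) \<in> \<mu> \<rightarrow>\<^sub>M count_space (range y)"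
    by (rule measurable_compose) simp
  moreover have "transport_map y c \<psi> x = y (THE j. j \<in> A x)" if "x \<in> space \<mu>" for x
    using that by (auto simp: transport_map_def A_def cell_def space_\<mu> eq_commute)
  ultimately show ?thesis
    by (simp cong: measurable_cong)
qed

text \<open>
  That \<open>l\<close> consists of the cell masses is what makes the second marginal right: up to a null set, the
  preimage of \<open>y\<^sub>j\<close> under the transport map is the cell of \<open>j\<close>.
\<close>

lemma graph_pushforward_coupling:
  assumes l: "l = cell_masses \<psi>"
  defines "\<gamma> \<equiv> graph_pushforward X y \<mu> (transport_map y c \<psi>)"
  shows "\<gamma> \<in> couplings \<mu> (nu y l)" and "(\<integral>z. slack \<psi> z \<partial>\<gamma>) = 0"
proof -
  let ?T = "transport_map y c \<psi>"
  have s: "sets (borel_on X \<Otimes>\<^sub>M borel_on (range y)) = sets (\<mu> \<Otimes>\<^sub>M nu y l)"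
    by (intro sets_pair_measure_cong) (auto simp: sets_\<mu> sets_nu sets_borel_on_finite)
  have T[measurable]: "?T \<in> \<mu> \<rightarrow>\<^sub>M nu y l"
    using measurable_transport_map measurable_cong_sets[of \<mu> \<mu> "nu y l" "count_space (range y)"]
    by (simp add: sets_nu)
  have Id_T: "(\<lambda>x. (x, ?T x)) \<in> \<mu> \<rightarrow>\<^sub>M borel_on X \<Otimes>\<^sub>M borel_on (range y)"
    unfolding measurable_cong_sets[OF refl s] by measurable
  have sg: "sets \<gamma> = sets (\<mu> \<Otimes>\<^sub>M nu y l)"
    by (simp add: \<gamma>_def graph_pushforward_def s)
  have fs: "fst \<in> borel_on X \<Otimes>\<^sub>M borel_on (range y) \<rightarrow>\<^sub>M \<mu>"
    "snd \<in> borel_on X \<Otimes>\<^sub>M borel_on (range y) \<rightarrow>\<^sub>M nu y l"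
    by (auto simp: measurable_cong_sets[OF s refl])
  have "distr \<gamma> \<mu> fst = distr \<mu> \<mu> (\<lambda>x. x)"
    unfolding \<gamma>_def graph_pushforward_def by (subst distr_distr[OF fs(1) Id_T]) (simp add: comp_def)
  then have fst: "distr \<gamma> \<mu> fst = \<mu>" by simp
  have "distr \<gamma> (nu y l) snd = distr \<mu> (nu y l) ?T"
    unfolding \<gamma>_def graph_pushforward_def by (subst distr_distr[OF fs(2) Id_T]) (simp add: comp_def)
  also have "\<dots> = nu y l"
  proof (rule measure_eqI_finite)
    show "sets (distr \<mu> (nu y l) ?T) = Pow (range y)" "sets (nu y l) = Pow (range y)"
      by (simp_all add: sets_nu)
    show "finite (range y)" by simp
    fix a assume "a \<in> range y"
    then obtain j where a: "a = y j" by blast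
    have "AE x in \<mu>. x \<in> ?T -` {y j} \<inter> space \<mu> \<longleftrightarrow> x \<in> cell \<psi> j"
      using AE_in_unique_cell[of \<psi>] AE_space
    proof eventually_elim
      case (elim x)
      then obtain k where k: "x \<in> cell \<psi> k" by blast
      with elim transport_map_in_cell[OF elim(1) k] inj_y show ?case
        by (auto simp: inj_eq)
    qed
    then have "emeasure \<mu> (?T -` {y j} \<inter> space \<mu>) = emeasure \<mu> (cell \<psi> j)"
      using cell_sets measurable_sets[OF T, of "{y j}"] by (intro emeasure_eq_AE) (auto simp: sets_nu)
    then have "emeasure (distr \<mu> (nu y l) ?T) {a} = ennreal (l $ j)"
      using a by (subst emeasure_distr[OF T]) (auto simp: sets_nu l cell_masses_def emeasure_eq_measure)
    also have "\<dots> = (\<Sum>i\<in>UNIV. if i = j then ennreal (l $ i) else 0)" by simp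
    also have "\<dots> = (\<Sum>i\<in>UNIV. ennreal (l $ i) * indicator {y j} (y i))"
      using inj_y by (intro sum.cong) (auto simp: indicator_def inj_eq)
    also have "\<dots> = emeasure (nu y l) {a}"
      unfolding a by (rule emeasure_nu[symmetric]) simp
    finally show "emeasure (distr \<mu> (nu y l) ?T) {a} = emeasure (nu y l) {a}" .
  qed
  finally have snd: "distr \<gamma> (nu y l) snd = nu y l" .
  have "prob_space \<gamma>"
    unfolding \<gamma>_def graph_pushforward_def using Id_T by (rule prob_space_distr)
  with sg fst snd show g: "\<gamma> \<in> couplings \<mu> (nu y l)"
    by (simp add: couplings_def)
  have "slack \<psi> \<in> borel_measurable \<gamma>"
    using cost_via_slack(1)[OF g] cell_masses_simplex l by (blast intro: borel_measurable_integrable)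
  then have sm: "slack \<psi> \<in> borel_measurable (borel_on X \<Otimes>\<^sub>M borel_on (range y))"
    by (simp add: \<gamma>_def graph_pushforward_def)
  have "(\<integral>z. slack \<psi> z \<partial>\<gamma>) = (\<integral>x. slack \<psi> (x, ?T x) \<partial>\<mu>)"
    unfolding \<gamma>_def graph_pushforward_def by (rule integral_distr[OF Id_T sm])
  also have "\<dots> = 0"
  proof (rule integral_eq_zero_AE)
    show "AE x in \<mu>. slack \<psi> (x, ?T x) = 0"
      using AE_in_unique_cell[of \<psi>] AE_space
    proof eventually_elim
      case (elim x)
      then obtain k where k: "x \<in> cell \<psi> k" by blast
      with elim transport_map_in_cell[OF elim(1) k] show ?case
        by (simp add: slack_zero_iff space_\<mu>)
    qed
  qed
  finally show "(\<integral>z. slack \<psi> z \<partial>\<gamma>) = 0" .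
qed

text \<open>
  The inequality \<open>\<psi>\<^sup>c\<^sup>*\<^sup>c \<le> \<psi>\<close> always holds; a point of the cell of \<open>j\<close> shows that it is sharp at \<open>j\<close>.
\<close>

lemma double_transform_on_charged_cell:
  assumes "cell_masses \<psi> $ j > 0"
  shows "ereal (\<psi> $ j) = c_transform X y c (\<lambda>x. ereal (cs \<psi> x)) j"
proof -
  have "cell \<psi> j \<noteq> {}" using assms by (auto simp: cell_masses_def)
  then obtain x where x: "x \<in> X" "- c (x, y j) - \<psi> $ j = cs \<psi> x"
    by (auto simp: cell_def)
  show ?thesis
  proof (rule antisym)
    have "ereal (\<psi> $ j) = ereal (- c (x, y j)) - ereal (cs \<psi> x)" using x(2) by simp
    also have "\<dots> \<le> c_transform X y c (\<lambda>x. ereal (cs \<psi> x)) j"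
      unfolding c_transform_def using x(1) by (rule SUP_upper)
    finally show "ereal (\<psi> $ j) \<le> c_transform X y c (\<lambda>x. ereal (cs \<psi> x)) j" .
    show "c_transform X y c (\<lambda>x. ereal (cs \<psi> x)) j \<le> ereal (\<psi> $ j)"
      unfolding c_transform_def
    proof (rule SUP_least)
      fix x show "ereal (- c (x, y j)) - ereal (cs \<psi> x) \<le> ereal (\<psi> $ j)"
        using cs_ge[of x j \<psi>] by simp
    qed
  qed
qed

end

section \<open>Duality and optimality\<close>

locale semidiscrete_problem = semidiscrete X y \<mu> c
  for X :: "(real^'n) set" and y :: "'m::finite \<Rightarrow> real^'n" and \<mu> c +
  fixes F :: "real^'m \<Rightarrow> ereal"
  assumes F_proper: "proper F" and F_finite_below: "\<forall>l. F l \<noteq> -\<infinity>"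
    and F_lsc: "lsc F" and F_convex: "ereal_convex F"
begin

lemma cstar_dual_feasible: "dual_feasible X y c (cs \<psi>, \<psi>)"
proof -
  have "- cs \<psi> x - \<psi> $ j \<le> c (x, y j)" for x j
    using cs_ge[of x j \<psi>] by linarith
  then show ?thesis by (simp add: dual_feasible_def continuous_cs)
qed

lemma dual_feasible_integral_ge:
  assumes "dual_feasible X y c (\<phi>, \<psi>)"
  shows "(\<integral>x. cs \<psi> x \<partial>\<mu>) \<le> (\<integral>x. \<phi> x \<partial>\<mu>)"
proof (rule integral_mono)
  have \<phi>: "continuous_on X \<phi>" "\<And>x j. x \<in> X \<Longrightarrow> - \<phi> x - \<psi> $ j \<le> c (x, y j)"
    using assms by (auto simp: dual_feasible_def)
  show "integrable \<mu> (cs \<psi>)" "integrable \<mu> \<phi>"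
    using \<phi>(1) continuous_cs by (auto intro: integrable_on_X)
  show "cs \<psi> x \<le> \<phi> x" if "x \<in> space \<mu>" for x
    unfolding cs_le_iff
  proof
    fix j show "- c (x, y j) - \<psi> $ j \<le> \<phi> x"
      using \<phi>(2)[of x j] that by (simp add: space_\<mu>)
  qed
qed

lemma weak_duality:
  assumes p: "primal_feasible \<mu> y p" and d: "dual_feasible X y c d"
  shows "dual_value \<mu> F d \<le> primal_value c F p"
proof -
  obtain \<gamma> l where p_eq: "p = (\<gamma>, l)" by (cases p)
  obtain \<phi> \<psi> where d_eq: "d = (\<phi>, \<psi>)" by (cases d)
  have g: "\<gamma> \<in> couplings \<mu> (nu y l)" and l: "l \<in> simplex_weights"
    using p by (auto simp: primal_feasible_def p_eq)
  have "- (\<integral>x. \<phi> x \<partial>\<mu>) - \<psi> \<bullet> l \<le> (\<integral>z. c z \<partial>\<gamma>)"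
    using dual_feasible_integral_ge[OF d[unfolded d_eq]] cost_via_slack(2)[OF g l, of \<psi>]
      integral_slack_nonneg[OF g, of \<psi>] by linarith
  then show ?thesis
    using fenchel_young[of F l \<psi>] F_finite_below[rule_format, of l]
      legendre_neq_minus_infinity[OF F_proper, of \<psi>]
    by (cases "F l"; cases "legendre F \<psi>") (auto simp: p_eq d_eq dual_value_def primal_value_def)
qed

text \<open>
  Both nonnegative terms that separate primal and dual values vanish for this coupling, so the pair
  certifies its own optimality through weak duality.
\<close>

lemma subdifferential_certificate:
  assumes sub: "\<psi> \<in> subdifferential F l" and l: "l = cell_masses \<psi>"
  defines "\<gamma> \<equiv> graph_pushforward X y \<mu> (transport_map y c \<psi>)"
  shows "primal_feasible \<mu> y (\<gamma>, l)"
    and "primal_value c F (\<gamma>, l) = dual_value \<mu> F (cs \<psi>, \<psi>)"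
proof -
  have g: "\<gamma> \<in> couplings \<mu> (nu y l)" "(\<integral>z. slack \<psi> z \<partial>\<gamma>) = 0"
    unfolding \<gamma>_def using graph_pushforward_coupling[OF l] by auto
  have lw: "l \<in> simplex_weights" using l cell_masses_simplex by simp
  show "primal_feasible \<mu> y (\<gamma>, l)" using g lw by (simp add: primal_feasible_def)
  obtain u where "F l = ereal u" "legendre F \<psi> = ereal (\<psi> \<bullet> l - u)"
    using sub subdifferential_iff_fenchel_equality[OF F_proper F_finite_below] by blast
  then show "primal_value c F (\<gamma>, l) = dual_value \<mu> F (cs \<psi>, \<psi>)"
    using g(2) cost_via_slack(2)[OF g(1) lw, of \<psi>] by (simp add: primal_value_def dual_value_def)
qed

lemma optimal_if_certificate:
  assumes "\<psi> \<in> subdifferential F l" and "l = cell_masses \<psi>"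
  shows "dual_maximizer X \<mu> y c F (cs \<psi>, \<psi>)"
    and "primal_minimizer \<mu> y c F (graph_pushforward X y \<mu> (transport_map y c \<psi>), l)"
proof -
  note cert = subdifferential_certificate[OF assms]
  have "\<not> dual_value \<mu> F d > dual_value \<mu> F (cs \<psi>, \<psi>)" if "dual_feasible X y c d" for d
    using weak_duality[OF cert(1) that] cert(2) by simp
  then show "dual_maximizer X \<mu> y c F (cs \<psi>, \<psi>)"
    unfolding dual_maximizer_def is_arg_max_def using cstar_dual_feasible by blast
  have "\<not> primal_value c F p < dual_value \<mu> F (cs \<psi>, \<psi>)" if "primal_feasible \<mu> y p" for p
    using weak_duality[OF that cstar_dual_feasible[of \<psi>]] by simp
  then show "primal_minimizer \<mu> y c F (graph_pushforward X y \<mu> (transport_map y c \<psi>), l)"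
    unfolding primal_minimizer_def is_arg_min_def using cert by auto
qed

text \<open>
  The finiteness of \<open>F\<^sup>* \<psi>\<close> comes from comparison with a point where \<open>F\<^sup>*\<close> is finite. The component
  \<open>\<phi>\<close> of the maximizer drops out, because \<open>\<psi>\<^sup>c\<^sup>*\<close> is the least admissible choice on \<open>X\<close>.
\<close>

lemma dual_maximizer_minimizes:
  assumes "dual_maximizer X \<mu> y c F (\<phi>, \<psi>)"
  obtains r where "legendre F \<psi> = ereal r"
    and "\<And>\<xi> s. legendre F \<xi> = ereal s \<Longrightarrow>
      (\<integral>x. cs \<psi> x \<partial>\<mu>) + r \<le> (\<integral>x. cs \<xi> x \<partial>\<mu>) + s"
proof -
  have feas: "dual_feasible X y c (\<phi>, \<psi>)"
    and max: "\<And>d. dual_feasible X y c d \<Longrightarrow> dual_value \<mu> F d \<le> dual_value \<mu> F (\<phi>, \<psi>)"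
    using assms by (auto simp: dual_maximizer_def is_arg_max_def not_less)
  have max': "dual_value \<mu> F (cs \<xi>, \<xi>) \<le> dual_value \<mu> F (\<phi>, \<psi>)" for \<xi>
    by (rule max[OF cstar_dual_feasible])
  obtain \<xi>0 s0 where s0: "legendre F \<xi>0 = ereal s0"
    using legendre_finite_somewhere F_lsc F_convex F_proper F_finite_below by metis
  obtain r where r: "legendre F \<psi> = ereal r"
    using max'[of \<xi>0] s0 legendre_neq_minus_infinity[OF F_proper, of \<psi>]
    by (cases "legendre F \<psi>") (auto simp: dual_value_def)
  have "(\<integral>x. cs \<psi> x \<partial>\<mu>) + r \<le> (\<integral>x. cs \<xi> x \<partial>\<mu>) + s" if "legendre F \<xi> = ereal s" for \<xi> s
    using max'[of \<xi>] dual_feasible_integral_ge[OF feas] r that by (simp add: dual_value_def)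
  with r show ?thesis by (rule that)
qed

text \<open>
  Fermat's rule for \<open>H + F\<^sup>*\<close>: along a segment, convexity bounds the increase of \<open>F\<^sup>*\<close> by a linear
  function, while the increase of \<open>H\<close> is \<open>- (cell masses) \<bullet> h\<close> to first order.
\<close>

lemma first_order_condition:
  assumes r: "legendre F \<psi> = ereal r"
    and min: "\<And>\<xi> s. legendre F \<xi> = ereal s \<Longrightarrow>
      (\<integral>x. cs \<psi> x \<partial>\<mu>) + r \<le> (\<integral>x. cs \<xi> x \<partial>\<mu>) + s"
  shows "\<psi> \<in> subdifferential F (cell_masses \<psi>)"
proof (rule subdifferential_if_conjugate_subgradient[OF F_lsc F_convex F_proper F_finite_below r])
  fix \<xi> s assume s: "legendre F \<xi> = ereal s"
  define h where "h = \<xi> - \<psi>"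
  have "r - s \<le> - (cell_masses \<psi> \<bullet> h)"
  proof (rule LIMSEQ_le_const[OF integral_cs_directional_derivative], intro exI allI impI)
    fix n :: nat
    define t where "t = inverse (real (Suc n))"
    have t: "0 < t" "t \<le> 1" by (auto simp: t_def inverse_le_1_iff)
    obtain u where u: "legendre F (\<psi> + t *\<^sub>R (\<xi> - \<psi>)) = ereal u" "u \<le> r + t * (s - r)"
      using legendre_convex_segment[OF F_finite_below F_proper r s] t by (metis less_imp_le)
    have "t * (r - s) \<le> (\<integral>x. cs (\<psi> + t *\<^sub>R h) x \<partial>\<mu>) - (\<integral>x. cs \<psi> x \<partial>\<mu>)"
      using min[OF u(1)] u(2) by (simp add: h_def algebra_simps)
    then show "r - s \<le> ((\<integral>x. cs (\<psi> + inverse (real (Suc n)) *\<^sub>R h) x \<partial>\<mu>) - (\<integral>x. cs \<psi> x \<partial>\<mu>))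
        / inverse (real (Suc n))"
      using t(1) unfolding t_def[symmetric] by (simp add: pos_le_divide_eq mult.commute)
  qed
  then show "r + (\<xi> - \<psi>) \<bullet> cell_masses \<psi> \<le> s"
    by (simp add: h_def inner_commute)
qed

text \<open>
  The cell masses provide a primal competitor whose value is the dual value at \<open>\<psi>\<close>. Hence the primal
  minimizer is at least as good, which leaves no room for a positive slack integral or a positive
  Fenchel-Young gap. That the minimizing weights are the cell masses is a consequence.
\<close>

lemma optimal_pair_characterization:
  assumes d: "dual_maximizer X \<mu> y c F (\<phi>, \<psi>)" and p: "primal_minimizer \<mu> y c F (\<gamma>, l)"
  shows "\<psi> \<in> subdifferential F l" and "l = cell_masses \<psi>"
proof -
  obtain r where r: "legendre F \<psi> = ereal r"
    and min: "\<And>\<xi> s. legendre F \<xi> = ereal s \<Longrightarrow>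
      (\<integral>x. cs \<psi> x \<partial>\<mu>) + r \<le> (\<integral>x. cs \<xi> x \<partial>\<mu>) + s"
    using dual_maximizer_minimizes[OF d] by metis
  have sub: "\<psi> \<in> subdifferential F (cell_masses \<psi>)"
    using r min by (rule first_order_condition)
  note cert = subdifferential_certificate[OF sub refl]
  have feas: "primal_feasible \<mu> y (\<gamma>, l)" using p by (simp add: primal_minimizer_def is_arg_min_def)
  then have g: "\<gamma> \<in> couplings \<mu> (nu y l)" and l: "l \<in> simplex_weights"
    by (auto simp: primal_feasible_def)
  have "primal_value c F (\<gamma>, l) \<le> dual_value \<mu> F (cs \<psi>, \<psi>)"
    using p cert unfolding primal_minimizer_def is_arg_min_def by (metis not_less)
  then have le: "ereal (\<integral>z. c z \<partial>\<gamma>) + F l \<le> ereal (- (\<integral>x. cs \<psi> x \<partial>\<mu>) - r)"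
    by (simp add: primal_value_def dual_value_def r)
  then obtain u where u: "F l = ereal u"
    using F_finite_below[rule_format, of l] by (cases "F l") auto
  have "\<psi> \<bullet> l \<le> u + r" using fenchel_young[of F l \<psi>] u r by simp
  with le u cost_via_slack(2)[OF g l, of \<psi>] integral_slack_nonneg[OF g, of \<psi>]
  have "(\<integral>z. slack \<psi> z \<partial>\<gamma>) = 0" "r = \<psi> \<bullet> l - u" by auto
  then show "l = cell_masses \<psi>" "\<psi> \<in> subdifferential F l"
    using cell_masses_eq_if_slack_zero[OF g l] u r
      subdifferential_iff_fenchel_equality[OF F_proper F_finite_below] by auto
qed

end

section \<open>Consequences of the twist condition\<close>

text \<open>
  An indifference set is a level set of a difference of costs, whose gradient the twist condition
  keeps away from zero.
\<close>

lemma twist_no_ties: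
  fixes X :: "(real^'n) set" and y :: "'m::finite \<Rightarrow> real^'n"
  assumes X: "compact X" and \<mu>: "sets \<mu> = sets (borel_on X)"
    and C1: "\<forall>j. C1_with_gradient X (\<lambda>x. c (x, y j)) (Dc j)"
    and ac: "absolutely_continuous (restrict_space lborel X) \<mu>"
    and tw: "twist X Dc" and jk: "j \<noteq> k"
  shows "AE x in \<mu>. c (x, y j) - c (x, y k) \<noteq> t"
proof -
  have "closed X" using X by (rule compact_imp_closed)
  let ?f = "\<lambda>x. c (x, y j) - c (x, y k) - t"
  have der: "(?f has_derivative (\<lambda>h. (Dc j x - Dc k x) \<bullet> h)) (at x within X)" if "x \<in> X" for x
    using C1 that unfolding C1_with_gradient_def
    by (auto intro!: derivative_eq_intros simp: inner_diff_left)
  have "{x \<in> X. ?f x = 0} \<in> null_sets lborel"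
  proof (rule null_zero_set_if_gradient_nonzero[OF \<open>closed X\<close> _ _ der])
    show "continuous_on X ?f"
      using der by (intro has_derivative_continuous_on)
    show "continuous_on X (\<lambda>x. Dc j x - Dc k x)"
      using C1 unfolding C1_with_gradient_def by (intro continuous_on_diff) auto
    show "Dc j x - Dc k x \<noteq> 0" if "x \<in> X" for x
      using tw jk that by (auto simp: twist_def)
  qed
  then have "{x \<in> X. ?f x = 0} \<in> null_sets (restrict_space lborel X)"
    using \<open>closed X\<close> by (subst null_sets_restrict_space) auto
  then have "{x \<in> X. ?f x = 0} \<in> null_sets \<mu>"
    using ac unfolding absolutely_continuous_def by blast
  moreover have "space \<mu> = X"
    using sets_eq_imp_space_eq[OF \<mu>] by (simp add: space_restrict_space)
  ultimately show ?thesis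
    by (intro AE_I'[of "{x \<in> X. ?f x = 0}"]) auto
qed

theorem theorem4p7:
  fixes X :: "(real^'n) set"
    and y :: "'m::finite \<Rightarrow> real^'n"
    and \<mu> :: "(real^'n) measure"
    and c :: "(real^'n) \<times> (real^'n) \<Rightarrow> real"
    and Dc :: "'m \<Rightarrow> real^'n \<Rightarrow> real^'n"
    and F :: "real^'m \<Rightarrow> ereal"
  assumes "inj y"
    and "compact X"
    and "prob_space \<mu>" and "sets \<mu> = sets (borel_on X)" and "spt \<mu> = X"
    and "continuous_on (X \<times> range y) c" and "\<forall>z \<in> X \<times> range y. c z \<ge> 0"
    and "\<forall>j. C1_with_gradient X (\<lambda>x. c (x, y j)) (Dc j)"
    and "\<forall>l. F l \<noteq> -\<infinity>" and "proper F" and "lsc F" and "ereal_convex F"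
    and "effective_domain F \<subseteq> simplex_weights"
    and "absolutely_continuous (restrict_space lborel X) \<mu>"
    and "twist X Dc"
  shows "(\<forall>\<phi> \<psi> \<gamma> l.
            dual_maximizer X \<mu> y c F (\<phi>, \<psi>) \<and> primal_minimizer \<mu> y c F (\<gamma>, l) \<longrightarrow>
              \<psi> \<in> subdifferential F l \<and>
              (\<forall>j. l $ j = measure \<mu> {x \<in> X. - c (x, y j) - \<psi> $ j = cstar_transform y c \<psi> x}) \<and>
              (\<forall>j. l $ j > 0 \<longrightarrow>
                 ereal (\<psi> $ j) = c_transform X y c (\<lambda>x. ereal (cstar_transform y c \<psi> x)) j)) \<and>
         (\<forall>\<psi> l.
            l \<in> simplex_weights \<and>
            \<psi> \<in> subdifferential F l \<and>
            (\<forall>j. l $ j = measure \<mu> {x \<in> X. - c (x, y j) - \<psi> $ j = cstar_transform y c \<psi> x}) \<longrightarrow>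
              dual_maximizer X \<mu> y c F (cstar_transform y c \<psi>, \<psi>) \<and>
              primal_minimizer \<mu> y c F (graph_pushforward X y \<mu> (transport_map y c \<psi>), l))"
proof -
  interpret semidiscrete_problem X y \<mu> c F
  proof (intro semidiscrete_problem.intro semidiscrete.intro semidiscrete_problem_axioms.intro)
    show "AE x in \<mu>. c (x, y j) - c (x, y k) \<noteq> t" if "j \<noteq> k" for j k t
      using assms that by (intro twist_no_ties)
  qed (rule assms)+
  have masses: "(\<forall>j. l $ j = measure \<mu> {x \<in> X. - c (x, y j) - \<psi> $ j = cs \<psi> x}) \<longleftrightarrow>
      l = cell_masses \<psi>" for l \<psi>
    by (simp add: vec_eq_iff cell_masses_def cell_def)
  show ?thesis
    unfolding masses
  proof (intro conjI allI impI; elim conjE)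
    fix \<phi> \<psi> \<gamma> l
    assume "dual_maximizer X \<mu> y c F (\<phi>, \<psi>)" "primal_minimizer \<mu> y c F (\<gamma>, l)"
    then show "\<psi> \<in> subdifferential F l" and l: "l = cell_masses \<psi>"
      by (rule optimal_pair_characterization)+
    show "ereal (\<psi> $ j) = c_transform X y c (\<lambda>x. ereal (cs \<psi> x)) j" if "0 < l $ j" for j
      using that unfolding l by (rule double_transform_on_charged_cell)
  next
    fix \<psi> l
    assume "\<psi> \<in> subdifferential F l" "l = cell_masses \<psi>"
    then show "dual_maximizer X \<mu> y c F (cs \<psi>, \<psi>)"
      and "primal_minimizer \<mu> y c F (graph_pushforward X y \<mu> (transport_map y c \<psi>), l)"
      by (rule optimal_if_certificate)+
  qed
qed

end
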